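(* The $\pi$-calculus is strongly replacement free: for every $\pi$-calculus context $C$, every invisible $\pi$-calculus process $I$ and every $\pi$-calculus process $P$, if $C[I]\Downarrow$ then $C[P]\Downarrow$.
   Context: The $\pi$-calculus is Milner–Parrow–Walker's $\pi$-calculus (without the match operator) with its standard labelled transition semantics; input, output and bound output actions are visible, $\tau$ is invisible. A context is a term with one hole $[\cdot]$; $C[P]$ is the result of filling the hole with $P$. $\Rightarrow$ is the reflexive-transitive closure of $\xrightarrow{\tau}$. $P\Downarrow$ iff there exist a visible action $\alpha$ and $P'$ with $P\Rightarrow\xrightarrow{\alpha}\Rightarrow P'$; $P$ is invisible iff not $P\Downarrow$. *)

theory Defs
  imports Main
begin

text \<open>
  The monadic \<pi>-calculus of Milner, Parrow and Walker ("A Calculus of Mobile Processes"), without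
  the match operator. Infinite behaviour comes from agent identifiers with defining equations, and
  the transition system is the late one. As in that paper, terms are not identified up to
  \<alpha>-conversion; the rules for input and scope opening choose the bound name of the action instead.
\<close>

type_synonym name = nat

datatype 'k proc =
    Null
  | Tau "'k proc"
  | Out name name "'k proc"   \<comment> \<open>\<open>Out a b P\<close> sends \<open>b\<close> along \<open>a\<close>\<close>
  | In name name "'k proc"    \<comment> \<open>\<open>In a x P\<close> receives along \<open>a\<close> and binds \<open>x\<close> in \<open>P\<close>\<close>
  | Res name "'k proc"        \<comment> \<open>\<open>Res x P\<close> binds \<open>x\<close> in \<open>P\<close>\<close>
  | Par "'k proc" "'k proc"
  | Sum "'k proc" "'k proc"
  | Ident 'k "name list"

primrec fn :: "'k proc \<Rightarrow> name set" where
  "fn Null = {}"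
| "fn (Tau P) = fn P"
| "fn (Out a b P) = {a, b} \<union> fn P"
| "fn (In a x P) = {a} \<union> (fn P - {x})"
| "fn (Res x P) = fn P - {x}"
| "fn (Par P Q) = fn P \<union> fn Q"
| "fn (Sum P Q) = fn P \<union> fn Q"
| "fn (Ident A ys) = set ys"

definition fresh :: "name set \<Rightarrow> name" where
  "fresh X = (LEAST z. z \<notin> X)"

text \<open>
  Capture-avoiding simultaneous substitution. Bound names are always renamed, to a name that is not
  the image of any name free in the scope of the binder; the result is the usual one up to
  \<alpha>-conversion. The choice depends only on the free names of the result, so that substitutions
  compose on the nose rather than merely up to \<alpha>-conversion.
\<close>

primrec subst :: "'k proc \<Rightarrow> (name \<Rightarrow> name) \<Rightarrow> 'k proc" where
  "subst Null \<sigma> = Null"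
| "subst (Tau P) \<sigma> = Tau (subst P \<sigma>)"
| "subst (Out a b P) \<sigma> = Out (\<sigma> a) (\<sigma> b) (subst P \<sigma>)"
| "subst (In a x P) \<sigma> =
     (let x' = fresh (\<sigma> ` (fn P - {x})) in In (\<sigma> a) x' (subst P (\<sigma>(x := x'))))"
| "subst (Res x P) \<sigma> =
     (let x' = fresh (\<sigma> ` (fn P - {x})) in Res x' (subst P (\<sigma>(x := x'))))"
| "subst (Par P Q) \<sigma> = Par (subst P \<sigma>) (subst Q \<sigma>)"
| "subst (Sum P Q) \<sigma> = Sum (subst P \<sigma>) (subst Q \<sigma>)"
| "subst (Ident A ys) \<sigma> = Ident A (map \<sigma> ys)"

abbreviation subst1 :: "'k proc \<Rightarrow> name \<Rightarrow> name \<Rightarrow> 'k proc" ("_\<lbrace>_'/_\<rbrace>" [1000, 0, 0] 1000) where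
  "P\<lbrace>y/x\<rbrace> \<equiv> subst P (id(x := y))"

definition list_map :: "name list \<Rightarrow> name list \<Rightarrow> name \<Rightarrow> name" where
  "list_map xs ys z = (case map_of (zip xs ys) z of None \<Rightarrow> z | Some y \<Rightarrow> y)"

text \<open>
  \<open>D A = (xs, P)\<close> is the defining equation of \<open>A\<close>, with formal parameters \<open>xs\<close> and body \<open>P\<close>; in
  particular \<open>length xs\<close> is the arity of \<open>A\<close>. The predicates below say that identifiers are used
  with their arity, which is part of what it means to be a term of the calculus. Definitions may be
  mutually recursive and unguarded.
\<close>

type_synonym 'k defs = "'k \<Rightarrow> name list \<times> 'k proc"

primrec is_process :: "'k defs \<Rightarrow> 'k proc \<Rightarrow> bool" where
  "is_process D Null \<longleftrightarrow> True"
| "is_process D (Tau P) \<longleftrightarrow> is_process D P"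
| "is_process D (Out a b P) \<longleftrightarrow> is_process D P"
| "is_process D (In a x P) \<longleftrightarrow> is_process D P"
| "is_process D (Res x P) \<longleftrightarrow> is_process D P"
| "is_process D (Par P Q) \<longleftrightarrow> is_process D P \<and> is_process D Q"
| "is_process D (Sum P Q) \<longleftrightarrow> is_process D P \<and> is_process D Q"
| "is_process D (Ident A ys) \<longleftrightarrow> length ys = length (fst (D A))"

definition defining_equations :: "'k defs \<Rightarrow> bool" where
  "defining_equations D \<longleftrightarrow>
     (\<forall>A xs P. D A = (xs, P) \<longrightarrow> distinct xs \<and> fn P \<subseteq> set xs \<and> is_process D P)"

datatype act =
    TauA
  | OutA name name    \<comment> \<open>free output\<close>
  | InA name name     \<comment> \<open>input; the second name is bound\<close>
  | BOutA name name   \<comment> \<open>bound output; the second name is bound\<close>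

primrec bn :: "act \<Rightarrow> name set" where
  "bn TauA = {}"
| "bn (OutA a b) = {}"
| "bn (InA a w) = {w}"
| "bn (BOutA a w) = {w}"

primrec names :: "act \<Rightarrow> name set" where
  "names TauA = {}"
| "names (OutA a b) = {a, b}"
| "names (InA a w) = {a, w}"
| "names (BOutA a w) = {a, w}"

definition visible :: "act \<Rightarrow> bool" where
  "visible \<alpha> \<longleftrightarrow> \<alpha> \<noteq> TauA"

inductive step :: "'k defs \<Rightarrow> 'k proc \<Rightarrow> act \<Rightarrow> 'k proc \<Rightarrow> bool"
    ("_ \<turnstile> _ \<midarrow>_\<rightarrow> _" [60, 60, 0, 60] 50)
  for D :: "'k defs" where
  tau_act: "D \<turnstile> Tau P \<midarrow>TauA\<rightarrow> P"
| output_act: "D \<turnstile> Out a b P \<midarrow>OutA a b\<rightarrow> P"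
| input_act: "w \<notin> fn (Res z P) \<Longrightarrow> D \<turnstile> In a z P \<midarrow>InA a w\<rightarrow> P\<lbrace>w/z\<rbrace>"
| sum_left: "D \<turnstile> P \<midarrow>\<alpha>\<rightarrow> P' \<Longrightarrow> D \<turnstile> Sum P Q \<midarrow>\<alpha>\<rightarrow> P'"
| sum_right: "D \<turnstile> Q \<midarrow>\<alpha>\<rightarrow> Q' \<Longrightarrow> D \<turnstile> Sum P Q \<midarrow>\<alpha>\<rightarrow> Q'"
| ide: "D A = (xs, P) \<Longrightarrow> length ys = length xs \<Longrightarrow> D \<turnstile> subst P (list_map xs ys) \<midarrow>\<alpha>\<rightarrow> P'
    \<Longrightarrow> D \<turnstile> Ident A ys \<midarrow>\<alpha>\<rightarrow> P'"
| par_left: "D \<turnstile> P \<midarrow>\<alpha>\<rightarrow> P' \<Longrightarrow> bn \<alpha> \<inter> fn Q = {} \<Longrightarrow> D \<turnstile> Par P Q \<midarrow>\<alpha>\<rightarrow> Par P' Q"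
| par_right: "D \<turnstile> Q \<midarrow>\<alpha>\<rightarrow> Q' \<Longrightarrow> bn \<alpha> \<inter> fn P = {} \<Longrightarrow> D \<turnstile> Par P Q \<midarrow>\<alpha>\<rightarrow> Par P Q'"
| com_left: "D \<turnstile> P \<midarrow>OutA a b\<rightarrow> P' \<Longrightarrow> D \<turnstile> Q \<midarrow>InA a z\<rightarrow> Q'
    \<Longrightarrow> D \<turnstile> Par P Q \<midarrow>TauA\<rightarrow> Par P' (Q'\<lbrace>b/z\<rbrace>)"
| com_right: "D \<turnstile> P \<midarrow>InA a z\<rightarrow> P' \<Longrightarrow> D \<turnstile> Q \<midarrow>OutA a b\<rightarrow> Q'
    \<Longrightarrow> D \<turnstile> Par P Q \<midarrow>TauA\<rightarrow> Par (P'\<lbrace>b/z\<rbrace>) Q'"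
| close_left: "D \<turnstile> P \<midarrow>BOutA a w\<rightarrow> P' \<Longrightarrow> D \<turnstile> Q \<midarrow>InA a w\<rightarrow> Q'
    \<Longrightarrow> D \<turnstile> Par P Q \<midarrow>TauA\<rightarrow> Res w (Par P' Q')"
| close_right: "D \<turnstile> P \<midarrow>InA a w\<rightarrow> P' \<Longrightarrow> D \<turnstile> Q \<midarrow>BOutA a w\<rightarrow> Q'
    \<Longrightarrow> D \<turnstile> Par P Q \<midarrow>TauA\<rightarrow> Res w (Par P' Q')"
| res: "D \<turnstile> P \<midarrow>\<alpha>\<rightarrow> P' \<Longrightarrow> y \<notin> names \<alpha> \<Longrightarrow> D \<turnstile> Res y P \<midarrow>\<alpha>\<rightarrow> Res y P'"
| open_scope: "D \<turnstile> P \<midarrow>OutA a y\<rightarrow> P' \<Longrightarrow> y \<noteq> a \<Longrightarrow> w \<notin> fn (Res y P')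
    \<Longrightarrow> D \<turnstile> Res y P \<midarrow>BOutA a w\<rightarrow> P'\<lbrace>w/y\<rbrace>"

definition tau_steps :: "'k defs \<Rightarrow> 'k proc \<Rightarrow> 'k proc \<Rightarrow> bool" ("_ \<turnstile> _ \<Rightarrow>\<^sub>\<tau> _" [60, 60, 60] 50) where
  "D \<turnstile> P \<Rightarrow>\<^sub>\<tau> P' \<longleftrightarrow> (\<lambda>Q Q'. D \<turnstile> Q \<midarrow>TauA\<rightarrow> Q')\<^sup>*\<^sup>* P P'"

definition weakly_visible :: "'k defs \<Rightarrow> 'k proc \<Rightarrow> bool" ("_ \<turnstile> _\<Down>" [60, 60] 50) where
  "D \<turnstile> P\<Down> \<longleftrightarrow> (\<exists>\<alpha> P'. visible \<alpha> \<and>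
     (\<exists>Q Q'. D \<turnstile> P \<Rightarrow>\<^sub>\<tau> Q \<and> D \<turnstile> Q \<midarrow>\<alpha>\<rightarrow> Q' \<and> D \<turnstile> Q' \<Rightarrow>\<^sub>\<tau> P'))"

definition invisible :: "'k defs \<Rightarrow> 'k proc \<Rightarrow> bool" where
  "invisible D P \<longleftrightarrow> \<not> D \<turnstile> P\<Down>"

datatype 'k ctx =
    Hole
  | CTau "'k ctx"
  | COut name name "'k ctx"
  | CIn name name "'k ctx"
  | CRes name "'k ctx"
  | CParL "'k ctx" "'k proc"
  | CParR "'k proc" "'k ctx"
  | CSumL "'k ctx" "'k proc"
  | CSumR "'k proc" "'k ctx"

text \<open>Filling the hole is literal, so binders above it capture free names of the process filled in.\<close>

primrec fill :: "'k ctx \<Rightarrow> 'k proc \<Rightarrow> 'k proc" ("_\<lbrakk>_\<rbrakk>" [1000, 0] 1000) where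
  "Hole\<lbrakk>P\<rbrakk> = P"
| "(CTau C)\<lbrakk>P\<rbrakk> = Tau (C\<lbrakk>P\<rbrakk>)"
| "(COut a b C)\<lbrakk>P\<rbrakk> = Out a b (C\<lbrakk>P\<rbrakk>)"
| "(CIn a x C)\<lbrakk>P\<rbrakk> = In a x (C\<lbrakk>P\<rbrakk>)"
| "(CRes x C)\<lbrakk>P\<rbrakk> = Res x (C\<lbrakk>P\<rbrakk>)"
| "(CParL C Q)\<lbrakk>P\<rbrakk> = Par (C\<lbrakk>P\<rbrakk>) Q"
| "(CParR Q C)\<lbrakk>P\<rbrakk> = Par Q (C\<lbrakk>P\<rbrakk>)"
| "(CSumL C Q)\<lbrakk>P\<rbrakk> = Sum (C\<lbrakk>P\<rbrakk>) Q"
| "(CSumR Q C)\<lbrakk>P\<rbrakk> = Sum Q (C\<lbrakk>P\<rbrakk>)"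

primrec is_context :: "'k defs \<Rightarrow> 'k ctx \<Rightarrow> bool" where
  "is_context D Hole \<longleftrightarrow> True"
| "is_context D (CTau C) \<longleftrightarrow> is_context D C"
| "is_context D (COut a b C) \<longleftrightarrow> is_context D C"
| "is_context D (CIn a x C) \<longleftrightarrow> is_context D C"
| "is_context D (CRes x C) \<longleftrightarrow> is_context D C"
| "is_context D (CParL C Q) \<longleftrightarrow> is_context D C \<and> is_process D Q"
| "is_context D (CParR Q C) \<longleftrightarrow> is_process D Q \<and> is_context D C"
| "is_context D (CSumL C Q) \<longleftrightarrow> is_context D C \<and> is_process D Q"
| "is_context D (CSumR Q C) \<longleftrightarrow> is_process D Q \<and> is_context D C"

definition strongly_replacement_free :: "'k defs \<Rightarrow> bool" where
  "strongly_replacement_free D \<longleftrightarrow>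
     (\<forall>C I P. is_context D C \<longrightarrow> is_process D I \<longrightarrow> invisible D I \<longrightarrow> is_process D P \<longrightarrow>
        D \<turnstile> C\<lbrakk>I\<rbrakk>\<Down> \<longrightarrow> D \<turnstile> C\<lbrakk>P\<rbrakk>\<Down>)"

end

theory Submission
  imports Defs
begin

text \<open>
  Without match, identifying free names of a process can create new behaviour only by letting two
  prefixes with different free subjects communicate, and then the process already had a visible
  action. Hence invisibility is preserved by arbitrary substitutions. An invisible subterm never
  interacts with its context, and stays invisible under its own silent steps and under the
  substitutions caused by inputs and communications around it. So \<open>C\<lbrakk>P\<rbrakk>\<close> simulates \<open>C\<lbrakk>I\<rbrakk>\<close>, leaving
  the silent steps of (the descendants of) \<open>I\<close> unmatched.
\<close>

subsection \<open>Substitution\<close>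

text \<open>The obstacle is the bookkeeping of names. The replacing process has arbitrary free
  names, binders on the two sides drift apart as substitution renames them, transitions are
  sensitive to both, and derivatives of matching transitions agree only up to \<alpha>-conversion.
  Three devices keep this manageable. Equality under a binder, and later relatedness under a binder,
  is expressed by all instances of the bodies, so that no choice of bound name enters; one instance
  at a fresh name generates the others. The relation \<open>related\<close> carries a substitution
  as an environment instead of applying it to the left process, so that substituting on the right
  leaves the invisible subterms on the left alone. Finally, a transition of a fresh instance is
  pulled back to the body itself, since an injective substitution cannot identify two subjects. Thus
  the single lemma \<open>step_reflect\<close> serves two purposes: its exceptional case is excluded
  by invisibility for arbitrary substitutions and by injectivity for fresh renamings.\<close>

lemma finite_fn [simp]: "finite (fn P)"
  by (induction P) auto

lemma fresh_notin: "finite X \<Longrightarrow> fresh X \<notin> X"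
  unfolding fresh_def by (rule LeastI_ex) (rule ex_new_if_finite[OF infinite_UNIV_nat])

lemma ex_fresh:
  assumes "finite X"
  obtains v :: name where "v \<notin> X"
  using ex_new_if_finite[OF infinite_UNIV_nat assms] by blast

lemma subst_cong: "(\<And>n. n \<in> fn P \<Longrightarrow> \<sigma> n = \<tau> n) \<Longrightarrow> subst P \<sigma> = subst P \<tau>"
proof (induction P arbitrary: \<sigma> \<tau>)
  case (In a x P)
  \<comment> \<open>The new bound name is computed from this image alone, so both substitutions
    choose the same one.\<close>
  have "\<sigma> ` (fn P - {x}) = \<tau> ` (fn P - {x})"
    by (rule image_cong) (use In.prems in auto)
  moreover have "subst P (\<sigma>(x := v)) = subst P (\<tau>(x := v))" for v
    by (rule In.IH) (use In.prems in auto)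
  ultimately show ?case
    using In.prems by (simp add: Let_def)
next
  case (Res x P)
  have "\<sigma> ` (fn P - {x}) = \<tau> ` (fn P - {x})"
    by (rule image_cong) (use Res.prems in auto)
  moreover have "subst P (\<sigma>(x := v)) = subst P (\<tau>(x := v))" for v
    by (rule Res.IH) (use Res.prems in auto)
  ultimately show ?case
    by (simp add: Let_def)
next
  case (Tau P)
  have "subst P \<sigma> = subst P \<tau>" by (rule Tau.IH) (use Tau.prems in auto)
  then show ?case by simp
next
  case (Out a b P)
  have "subst P \<sigma> = subst P \<tau>" by (rule Out.IH) (use Out.prems in auto)
  then show ?case using Out.prems by simp
next
  case (Par P Q)
  have "subst P \<sigma> = subst P \<tau>" "subst Q \<sigma> = subst Q \<tau>"
    by (rule Par.IH; use Par.prems in auto)+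
  then show ?case by simp
next
  case (Sum P Q)
  have "subst P \<sigma> = subst P \<tau>" "subst Q \<sigma> = subst Q \<tau>"
    by (rule Sum.IH; use Sum.prems in auto)+
  then show ?case by simp
qed simp_all

lemma image_update_fresh:
  "v \<notin> \<sigma> ` (A - {x}) \<Longrightarrow> (\<sigma>(x := v)) ` A - {v} = \<sigma> ` (A - {x})"
  by auto

lemma subst_Res_fresh:
  obtains x' where "x' = fresh (\<sigma> ` (fn P - {x}))" "x' \<notin> \<sigma> ` (fn P - {x})"
    "subst (Res x P) \<sigma> = Res x' (subst P (\<sigma>(x := x')))"
    "\<And>a. subst (In a x P) \<sigma> = In (\<sigma> a) x' (subst P (\<sigma>(x := x')))"
  by (rule that) (simp_all add: Let_def fresh_notin)

lemma fn_subst: "fn (subst P \<sigma>) = \<sigma> ` fn P"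
proof (induction P arbitrary: \<sigma>)
  case (In a x P)
  obtain x' where "x' \<notin> \<sigma> ` (fn P - {x})"
    "\<And>b. subst (In b x P) \<sigma> = In (\<sigma> b) x' (subst P (\<sigma>(x := x')))"
    using subst_Res_fresh[of \<sigma> P x] by metis
  then show ?case
    by (simp only: fn.simps subst.simps In.IH image_Un image_insert image_empty image_update_fresh[of _ \<sigma> "fn P" x] not_False_eq_True simp_thms)
next
  case (Res x P)
  obtain x' where "x' \<notin> \<sigma> ` (fn P - {x})"
    "subst (Res x P) \<sigma> = Res x' (subst P (\<sigma>(x := x')))"
    using subst_Res_fresh[of \<sigma> P x] by metis
  then show ?case
    by (simp only: fn.simps Res.IH image_update_fresh[of x' \<sigma> "fn P" x] not_False_eq_True simp_thms)
qed auto

text \<open>After the first substitution, the free names of the scope without its new binder are the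
  images of the old ones, so the second substitution chooses the bound name that the composite
  chooses. The intermediate name \<open>x'\<close> is fresh and therefore leaves no trace.\<close>

lemma subst_comp: "subst (subst P \<sigma>) \<tau> = subst P (\<tau> \<circ> \<sigma>)"
proof (induction P arbitrary: \<sigma> \<tau>)
  case (In a x P)
  obtain x' where x': "x' \<notin> \<sigma> ` (fn P - {x})"
    "\<And>b. subst (In b x P) \<sigma> = In (\<sigma> b) x' (subst P (\<sigma>(x := x')))"
    using subst_Res_fresh[of \<sigma> P x] by metis
  have "fn (subst P (\<sigma>(x := x'))) - {x'} = \<sigma> ` (fn P - {x})"
    unfolding fn_subst by (rule image_update_fresh) (rule x')
  moreover have "subst P (\<tau>(x' := u) \<circ> \<sigma>(x := x')) = subst P ((\<tau> \<circ> \<sigma>)(x := u))" for u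
    by (rule subst_cong) (use x'(1) in auto)
  ultimately show ?case
    unfolding x'(2) by (simp only: subst.simps Let_def In.IH image_comp comp_apply[of \<tau> \<sigma> a])
next
  case (Res x P)
  obtain x' where x': "x' \<notin> \<sigma> ` (fn P - {x})"
    "subst (Res x P) \<sigma> = Res x' (subst P (\<sigma>(x := x')))"
    using subst_Res_fresh[of \<sigma> P x] by metis
  have "fn (subst P (\<sigma>(x := x'))) - {x'} = \<sigma> ` (fn P - {x})"
    unfolding fn_subst by (rule image_update_fresh) (rule x')
  moreover have "subst P (\<tau>(x' := u) \<circ> \<sigma>(x := x')) = subst P ((\<tau> \<circ> \<sigma>)(x := u))" for u
    by (rule subst_cong) (use x'(1) in auto)
  ultimately show ?case
    unfolding x'(2) by (simp only: subst.simps Let_def Res.IH image_comp)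
qed auto

text \<open>A fresh \<open>v\<close> marks exactly the occurrences of \<open>x\<close>, so it can be
  sent to any \<open>u\<close> afterwards while \<tau> treats the other names. This is the basic
  tool for passing between instances of a scope.\<close>

lemma subst_rebind:
  assumes "v \<notin> \<sigma> ` (fn P - {x})"
  shows "subst (subst P (\<sigma>(x := v))) (\<tau>(v := u)) = subst P ((\<tau> \<circ> \<sigma>)(x := u))"
  unfolding subst_comp by (rule subst_cong) (use assms in auto)

lemma subst_rebind1:
  assumes "v \<notin> fn P - {x}"
  shows "(subst P (id(x := v)))\<lbrace>u/v\<rbrace> = P\<lbrace>u/x\<rbrace>"
  using subst_rebind[of v id P x id u] assms by simp

text \<open>Quantifying over all instances removes the chosen bound name from \<alpha>-equivalence.
  From left to right, the common bound name is sent to \<open>v\<close>. Conversely, an instance at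
  a fresh name determines the free names of the two restrictions; these agree, and they determine
  the chosen bound name.\<close>

lemma subst_Res_eq_iff:
  "subst (Res x P) \<sigma> = subst (Res y Q) \<tau> \<longleftrightarrow>
    (\<forall>v. subst P (\<sigma>(x := v)) = subst Q (\<tau>(y := v)))" (is "?L \<longleftrightarrow> ?R")
proof
  define x' where "x' = fresh (\<sigma> ` (fn P - {x}))"
  have x': "x' \<notin> \<sigma> ` (fn P - {x})"
    unfolding x'_def by (rule fresh_notin) simp
  assume L: ?L
  then have eq: "x' = fresh (\<tau> ` (fn Q - {y}))"
    "subst P (\<sigma>(x := x')) = subst Q (\<tau>(y := x'))"
    by (auto simp: Let_def x'_def)
  have y': "x' \<notin> \<tau> ` (fn Q - {y})"
    unfolding eq(1) by (rule fresh_notin) simp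
  show ?R
  proof
    fix v
    have "subst (subst P (\<sigma>(x := x'))) (id(x' := v)) = subst (subst Q (\<tau>(y := x'))) (id(x' := v))"
      by (simp only: eq(2))
    then show "subst P (\<sigma>(x := v)) = subst Q (\<tau>(y := v))"
      using subst_rebind[OF x'] subst_rebind[OF y'] by simp
  qed
next
  assume R: ?R
  have "finite (\<sigma> ` (fn P - {x}) \<union> \<tau> ` (fn Q - {y}))"
    by simp
  then obtain v where v: "v \<notin> \<sigma> ` (fn P - {x}) \<union> \<tau> ` (fn Q - {y})"
    by (rule ex_fresh)
  have "(\<sigma>(x := v)) ` fn P - {v} = (\<tau>(y := v)) ` fn Q - {v}"
    using R by (metis fn_subst)
  then have "\<sigma> ` (fn P - {x}) = \<tau> ` (fn Q - {y})"
    using v by (metis UnI1 UnI2 image_update_fresh)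
  then show ?L
    using R by (simp add: Let_def)
qed

lemma subst_In_eq_iff:
  "subst (In a x P) \<sigma> = subst (In b y Q) \<tau> \<longleftrightarrow>
    \<sigma> a = \<tau> b \<and> (\<forall>v. subst P (\<sigma>(x := v)) = subst Q (\<tau>(y := v)))"
  using subst_Res_eq_iff[of x P \<sigma> y Q \<tau>] by (auto simp: Let_def)

text \<open>A fresh \<open>v\<close> acts as a placeholder: sending it to \<open>u\<close>
  afterwards yields every other instance.\<close>

lemma subst_Res_eqI:
  assumes "v \<notin> \<sigma> ` (fn P - {x})" "v \<notin> \<tau> ` (fn Q - {y})"
    and "subst P (\<sigma>(x := v)) = subst Q (\<tau>(y := v))"
  shows "subst (Res x P) \<sigma> = subst (Res y Q) \<tau>"
  unfolding subst_Res_eq_iff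
proof
  fix u
  show "subst P (\<sigma>(x := u)) = subst Q (\<tau>(y := u))"
    using subst_rebind[OF assms(1), of id u] subst_rebind[OF assms(2), of id u] assms(3) by simp
qed

lemma subst_fresh_update: "x \<notin> fn P \<Longrightarrow> subst P (\<sigma>(x := v)) = subst P \<sigma>"
  by (rule subst_cong) auto

lemma subst_same: "P\<lbrace>y/y\<rbrace> = subst P id"
  by (rule subst_cong) auto

lemma list_map_in: "length ys = length xs \<Longrightarrow> z \<in> set xs \<Longrightarrow> list_map xs ys z \<in> set ys"
proof (induction ys xs rule: list_induct2)
  case Nil then show ?case by simp
next
  case (Cons y ys x xs)
  then show ?case by (auto simp: list_map_def split: option.splits)
qed

lemma list_map_map:
  "length ys = length xs \<Longrightarrow> z \<in> set xs \<Longrightarrow> list_map xs (map \<sigma> ys) z = \<sigma> (list_map xs ys z)"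
proof (induction ys xs rule: list_induct2)
  case Nil then show ?case by simp
next
  case (Cons y ys x xs)
  then show ?case by (auto simp: list_map_def split: option.splits)
qed

subsection \<open>Transitions\<close>

lemma act_cases [case_names Tau Out Bound]:
  obtains "\<alpha> = TauA" | a b where "\<alpha> = OutA a b"
  | K a w where "K \<in> {InA, BOutA}" "\<alpha> = K a w"
  by (cases \<alpha>) auto

lemma bound_act [simp]:
  assumes "K \<in> {InA, BOutA}"
  shows "bn (K a w) = {w}" "names (K a w) = {a, w}"
  using assms by auto

lemma ex_cofinite: "\<forall>\<^sub>F w in cofinite. P w \<Longrightarrow> \<exists>w::name. P w"
  using eventually_happens[of P cofinite] by (auto simp: cofinite_bot)

lemma cofinite_notin: "finite X \<Longrightarrow> \<forall>\<^sub>F w in cofinite. w \<notin> X"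
  by (simp add: eventually_cofinite)

context
  fixes D :: "'k defs"
  assumes equations: "defining_equations D"
begin

lemma fn_equation: "D A = (xs, B) \<Longrightarrow> fn B \<subseteq> set xs"
  using equations unfolding defining_equations_def by blast

text \<open>All free names of a body are formal parameters. A free name outside the parameters would
  be moved by \<sigma> on the left only.\<close>

lemma subst_body:
  assumes "D A = (xs, B)" "length ys = length xs"
  shows "subst (subst B (list_map xs ys)) \<sigma> = subst B (list_map xs (map \<sigma> ys))"
  unfolding subst_comp
proof (rule subst_cong)
  fix n assume "n \<in> fn B"
  then show "(\<sigma> \<circ> list_map xs ys) n = list_map xs (map \<sigma> ys) n"
    using list_map_map[OF assms(2)] fn_equation[OF assms(1)] by auto
qed

lemma fn_body:
  assumes "D A = (xs, B)" "length ys = length xs"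
  shows "fn (subst B (list_map xs ys)) \<subseteq> set ys"
  using list_map_in[OF assms(2)] fn_equation[OF assms(1)] unfolding fn_subst by auto

lemma subject_in_fn: "D \<turnstile> P \<midarrow>\<alpha>\<rightarrow> P' \<Longrightarrow>
    case \<alpha> of TauA \<Rightarrow> True | OutA a b \<Rightarrow> a \<in> fn P \<and> b \<in> fn P | InA a w \<Rightarrow> a \<in> fn P | BOutA a w \<Rightarrow> a \<in> fn P"
proof (induction rule: step.induct)
  case (ide A xs P ys \<alpha> P')
  then show ?case using fn_body[OF ide(1,2)] by (cases \<alpha>) auto
qed (auto split: act.splits)

lemma fn_step: "D \<turnstile> P \<midarrow>\<alpha>\<rightarrow> P' \<Longrightarrow> fn P' \<subseteq> fn P \<union> bn \<alpha>"
proof (induction rule: step.induct)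
  case (ide A xs P ys \<alpha> P')
  then show ?case using fn_body[OF ide(1,2)] by auto
next
  case (com_left P a b P' Q z Q')
  then show ?case using subject_in_fn[OF com_left(1)] by (auto simp: fn_subst)
next
  case (com_right P a z P' Q b Q')
  then show ?case using subject_in_fn[OF com_right(2)] by (auto simp: fn_subst)
qed (auto simp: fn_subst)

lemma bound_subject_in_fn:
  "D \<turnstile> P \<midarrow>K a w\<rightarrow> P' \<Longrightarrow> K \<in> {InA, BOutA} \<Longrightarrow> a \<in> fn P"
  using subject_in_fn[of P "K a w" P'] by auto

subsection \<open>Steps of a substitution instance\<close>

text \<open>
  The free names of two related processes differ, so the bound name of an action cannot be kept.
  Every statement about input and bound output therefore allows all but finitely many bound names.
\<close>

definition barb :: "'k proc \<Rightarrow> name \<Rightarrow> bool" where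
  "barb P c \<longleftrightarrow> (\<exists>b P'. D \<turnstile> P \<midarrow>OutA c b\<rightarrow> P') \<or>
     (\<exists>K\<in>{InA, BOutA}. \<forall>\<^sub>F w in cofinite. \<exists>P'. D \<turnstile> P \<midarrow>K c w\<rightarrow> P')"

text \<open>A substitution creates a new communication only by merging two different subjects. Of
  the second name only its free occurrence is recorded: the barb on \<open>c\<close> already
  contradicts invisibility, and two distinct free names with one image already contradict
  injectivity.\<close>

definition clash :: "'k proc \<Rightarrow> (name \<Rightarrow> name) \<Rightarrow> bool" where
  "clash P \<sigma> \<longleftrightarrow> (\<exists>c\<in>fn P. \<exists>d\<in>fn P. c \<noteq> d \<and> \<sigma> c = \<sigma> d \<and> barb P c)"

text \<open>
  \<open>reflects \<sigma> P \<alpha> X'\<close>: the transition to \<open>X'\<close> of an \<alpha>-variant of \<open>subst P \<sigma>\<close> comes from one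
  of \<open>P\<close>. The equations \<open>subst _ \<sigma> = subst _ id\<close> express \<alpha>-equivalence, as \<open>subst _ id\<close> computes
  a canonical \<alpha>-variant.
\<close>

definition reflects_bound ::
    "(name \<Rightarrow> name \<Rightarrow> act) \<Rightarrow> (name \<Rightarrow> name) \<Rightarrow> 'k proc \<Rightarrow> name \<Rightarrow> name \<Rightarrow> 'k proc \<Rightarrow> bool" where
  "reflects_bound K \<sigma> P a w X' \<longleftrightarrow> (\<exists>a'. \<sigma> a' = a \<and>
     (\<forall>\<^sub>F w' in cofinite. \<exists>P'. D \<turnstile> P \<midarrow>K a' w'\<rightarrow> P' \<and> (\<forall>v. subst P' (\<sigma>(w' := v)) = X'\<lbrace>v/w\<rbrace>)))"

primrec reflects :: "(name \<Rightarrow> name) \<Rightarrow> 'k proc \<Rightarrow> act \<Rightarrow> 'k proc \<Rightarrow> bool" where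
  "reflects \<sigma> P TauA X' \<longleftrightarrow> (\<exists>P'. D \<turnstile> P \<midarrow>TauA\<rightarrow> P' \<and> subst P' \<sigma> = subst X' id)"
| "reflects \<sigma> P (OutA a b) X' \<longleftrightarrow> (\<exists>a' b' P'. D \<turnstile> P \<midarrow>OutA a' b'\<rightarrow> P' \<and>
     \<sigma> a' = a \<and> \<sigma> b' = b \<and> subst P' \<sigma> = subst X' id)"
| "reflects \<sigma> P (InA a w) X' \<longleftrightarrow> reflects_bound InA \<sigma> P a w X'"
| "reflects \<sigma> P (BOutA a w) X' \<longleftrightarrow> reflects_bound BOutA \<sigma> P a w X'"

lemma reflects_K: "K \<in> {InA, BOutA} \<Longrightarrow> reflects \<sigma> P (K a w) X' \<longleftrightarrow> reflects_bound K \<sigma> P a w X'"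
  by auto

lemma reflects_boundE:
  assumes "reflects_bound K \<sigma> P a w X'" "K \<in> {InA, BOutA}"
  obtains a' where "\<sigma> a' = a" "a' \<in> fn P" "barb P a'"
    "\<forall>\<^sub>F w' in cofinite. \<exists>P'. D \<turnstile> P \<midarrow>K a' w'\<rightarrow> P' \<and> (\<forall>v. subst P' (\<sigma>(w' := v)) = X'\<lbrace>v/w\<rbrace>)"
proof -
  obtain a' where a': "\<sigma> a' = a"
    "\<forall>\<^sub>F w' in cofinite. \<exists>P'. D \<turnstile> P \<midarrow>K a' w'\<rightarrow> P' \<and> (\<forall>v. subst P' (\<sigma>(w' := v)) = X'\<lbrace>v/w\<rbrace>)"
    using assms(1) unfolding reflects_bound_def by blast
  have "\<forall>\<^sub>F w in cofinite. \<exists>P'. D \<turnstile> P \<midarrow>K a' w\<rightarrow> P'"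
    using a'(2) by (rule eventually_mono) blast
  then have "barb P a'"
    using assms(2) unfolding barb_def by blast
  moreover have "a' \<in> fn P"
    using ex_cofinite[OF a'(2)] assms(2) bound_subject_in_fn by blast
  ultimately show ?thesis
    using that a' by blast
qed

section \<open>Closure of barbs, clashes and reflected transitions under the operators\<close>

lemma barb_mono:
  assumes "\<And>\<alpha> P'. D \<turnstile> P \<midarrow>\<alpha>\<rightarrow> P' \<Longrightarrow> D \<turnstile> Q \<midarrow>\<alpha>\<rightarrow> P'" "barb P c"
  shows "barb Q c"
proof -
  have "\<forall>\<^sub>F w in cofinite. \<exists>P'. D \<turnstile> Q \<midarrow>K c w\<rightarrow> P'"
    if "\<forall>\<^sub>F w in cofinite. \<exists>P'. D \<turnstile> P \<midarrow>K c w\<rightarrow> P'" for K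
    using that by (rule eventually_mono) (use assms(1) in blast)
  then show ?thesis
    using assms unfolding barb_def by metis
qed

lemma barb_Par_left: "barb P c \<Longrightarrow> barb (Par P Q) c"
  and barb_Par_right: "barb P c \<Longrightarrow> barb (Par Q P) c"
proof -
  assume b: "barb P c"
  have fr: "\<forall>\<^sub>F w in cofinite. w \<notin> fn Q"
    by (simp add: cofinite_notin)
  have "barb (Par P Q) c \<and> barb (Par Q P) c"
  proof (cases "\<exists>b P'. D \<turnstile> P \<midarrow>OutA c b\<rightarrow> P'")
    case True
    then show ?thesis
      unfolding barb_def using par_left[of D P "OutA c _"] par_right[of D P "OutA c _"]
      by (metis Int_empty_left bn.simps(2))
  next
    case False
    then obtain K where K: "K \<in> {InA, BOutA}" "\<forall>\<^sub>F w in cofinite. \<exists>P'. D \<turnstile> P \<midarrow>K c w\<rightarrow> P'"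
      using b unfolding barb_def by blast
    have "\<forall>\<^sub>F w in cofinite. \<exists>P'. D \<turnstile> Par P Q \<midarrow>K c w\<rightarrow> P'"
      using K(2) fr by eventually_elim (use K(1) par_left[of D P "K c _"] in fastforce)
    moreover have "\<forall>\<^sub>F w in cofinite. \<exists>P'. D \<turnstile> Par Q P \<midarrow>K c w\<rightarrow> P'"
      using K(2) fr by eventually_elim (use K(1) par_right[of D P "K c _"] in fastforce)
    ultimately show ?thesis
      using K(1) unfolding barb_def by blast
  qed
  then show "barb (Par P Q) c" "barb (Par Q P) c" by auto
qed

lemma barb_Res:
  assumes "barb P c" "c \<noteq> x"
  shows "barb (Res x P) c"
proof (cases "\<exists>b P'. D \<turnstile> P \<midarrow>OutA c b\<rightarrow> P'")
  case True
  then obtain b P' where P': "D \<turnstile> P \<midarrow>OutA c b\<rightarrow> P'" by blast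
  show ?thesis
  \<comment> \<open>Sending the restricted name itself turns into a bound output by scope opening:
    the barb stays on \<open>c\<close> but changes its kind.\<close>
  proof (cases "b = x")
    case True
    have "\<forall>\<^sub>F w in cofinite. w \<notin> fn (Res x P')"
      by (rule cofinite_notin) simp
    then have "\<forall>\<^sub>F w in cofinite. \<exists>P'. D \<turnstile> Res x P \<midarrow>BOutA c w\<rightarrow> P'"
      by eventually_elim (use P' True assms(2) in \<open>blast intro: open_scope\<close>)
    then show ?thesis unfolding barb_def by blast
  next
    case False
    then show ?thesis
      using res[OF P', of x] assms(2) unfolding barb_def by auto
  qed
next
  case False
  then obtain K where K: "K \<in> {InA, BOutA}" "\<forall>\<^sub>F w in cofinite. \<exists>P'. D \<turnstile> P \<midarrow>K c w\<rightarrow> P'"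
    using assms(1) unfolding barb_def by blast
  have "\<forall>\<^sub>F w in cofinite. w \<notin> {x}"
    by (rule cofinite_notin) simp
  with K(2) have "\<forall>\<^sub>F w in cofinite. \<exists>P'. D \<turnstile> Res x P \<midarrow>K c w\<rightarrow> P'"
    by eventually_elim (use K(1) assms(2) res[of D P "K c _" _ x] in fastforce)
  then show ?thesis
    using K(1) unfolding barb_def by blast
qed

lemma clash_mono:
  assumes "\<And>\<alpha> P'. D \<turnstile> P \<midarrow>\<alpha>\<rightarrow> P' \<Longrightarrow> D \<turnstile> Q \<midarrow>\<alpha>\<rightarrow> P'" "fn P \<subseteq> fn Q" "clash P \<sigma>"
  shows "clash Q \<sigma>"
  using assms barb_mono[of P Q] unfolding clash_def by blast

lemma clash_Par_left: "clash P \<sigma> \<Longrightarrow> clash (Par P Q) \<sigma>"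
  and clash_Par_right: "clash Q \<sigma> \<Longrightarrow> clash (Par P Q) \<sigma>"
  unfolding clash_def using barb_Par_left barb_Par_right by fastforce+

lemma clash_Par_subjects:
  assumes "barb P c" "c \<in> fn P" "d \<in> fn Q" "c \<noteq> d" "\<sigma> c = \<sigma> d"
  shows "clash (Par P Q) \<sigma>" "clash (Par Q P) \<sigma>"
  using assms barb_Par_left[of P c Q] barb_Par_right[of P c Q] unfolding clash_def by auto

text \<open>As \<open>z\<close> is not the image of another free name, the updated substitution
  merges \<open>x\<close> with nothing. Both clashing names thus differ from \<open>x\<close>, and
  neither they nor the barb are hidden by the restriction.\<close>

lemma clash_Res:
  assumes "clash P (\<sigma>(x := z))" "z \<notin> \<sigma> ` (fn P - {x})"
  shows "clash (Res x P) \<sigma>"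
proof -
  obtain c d where cd: "c \<in> fn P" "d \<in> fn P" "c \<noteq> d" "(\<sigma>(x := z)) c = (\<sigma>(x := z)) d" "barb P c"
    using assms(1) unfolding clash_def by blast
  have "c \<noteq> x" "d \<noteq> x"
    using cd assms(2) by (auto simp: image_iff split: if_splits)
  then show ?thesis
    using cd barb_Res[of P c x] unfolding clash_def by auto
qed

lemma reflects_mono:
  assumes "\<And>\<alpha> P'. D \<turnstile> P \<midarrow>\<alpha>\<rightarrow> P' \<Longrightarrow> D \<turnstile> Q \<midarrow>\<alpha>\<rightarrow> P'" "reflects \<sigma> P \<alpha> X'"
  shows "reflects \<sigma> Q \<alpha> X'"
proof (cases \<alpha> rule: act_cases)
  case (Bound K a w)
  then obtain a' where a': "\<sigma> a' = a"
    "\<forall>\<^sub>F w' in cofinite. \<exists>P'. D \<turnstile> P \<midarrow>K a' w'\<rightarrow> P' \<and> (\<forall>v. subst P' (\<sigma>(w' := v)) = X'\<lbrace>v/w\<rbrace>)"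
    using assms(2) unfolding reflects_K[OF Bound(1)] Bound(2) reflects_bound_def by blast
  have "\<forall>\<^sub>F w' in cofinite. \<exists>P'. D \<turnstile> Q \<midarrow>K a' w'\<rightarrow> P' \<and> (\<forall>v. subst P' (\<sigma>(w' := v)) = X'\<lbrace>v/w\<rbrace>)"
    using a'(2) by (rule eventually_mono) (use assms(1) in blast)
  then show ?thesis
    using a'(1) unfolding reflects_K[OF Bound(1)] Bound(2) reflects_bound_def by blast
qed (use assms in \<open>auto; blast\<close>)+

lemma reflects_Par:
  assumes "reflects \<sigma> P \<alpha> X'" "subst Q \<sigma> = subst Y id" "bn \<alpha> \<inter> fn Y = {}"
  shows "reflects \<sigma> (Par P Q) \<alpha> (Par X' Y)" "reflects \<sigma> (Par Q P) \<alpha> (Par Y X')"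
proof -
  have "reflects \<sigma> (Par P Q) \<alpha> (Par X' Y) \<and> reflects \<sigma> (Par Q P) \<alpha> (Par Y X')"
  proof (cases \<alpha> rule: act_cases)
    case Tau
    then obtain P' where "D \<turnstile> P \<midarrow>TauA\<rightarrow> P'" "subst P' \<sigma> = subst X' id"
      using assms(1) by auto
    then show ?thesis
      using Tau assms(2) par_left[of D P TauA P' Q] par_right[of D P TauA P' Q]
        reflects.simps(1) by (metis Int_empty_left bn.simps(1) subst.simps(6))
  next
    case (Out a b)
    then obtain a' b' P' where "D \<turnstile> P \<midarrow>OutA a' b'\<rightarrow> P'" "\<sigma> a' = a" "\<sigma> b' = b"
      "subst P' \<sigma> = subst X' id"
      using assms(1) by auto
    then show ?thesis
      using Out assms(2) par_left[of D P "OutA a' b'" P' Q] par_right[of D P "OutA a' b'" P' Q]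
        reflects.simps(2) by (metis Int_empty_left bn.simps(2) subst.simps(6))
  next
    case (Bound K a w)
    then obtain a' where a': "\<sigma> a' = a"
      "\<forall>\<^sub>F w' in cofinite. \<exists>P'. D \<turnstile> P \<midarrow>K a' w'\<rightarrow> P' \<and> (\<forall>v. subst P' (\<sigma>(w' := v)) = X'\<lbrace>v/w\<rbrace>)"
      using assms(1) unfolding reflects_K[OF Bound(1)] Bound(2) reflects_bound_def by blast
    have w: "w \<notin> fn Y"
      using assms(3) Bound by simp
    have fr: "\<forall>\<^sub>F w' in cofinite. w' \<notin> fn Q"
      by (simp add: cofinite_notin)
    have rest: "subst Q (\<sigma>(w' := v)) = Y\<lbrace>v/w\<rbrace>" if "w' \<notin> fn Q" for w' v
      using that w assms(2) by (simp add: subst_fresh_update)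
    have "\<forall>\<^sub>F w' in cofinite. \<exists>P'. D \<turnstile> Par P Q \<midarrow>K a' w'\<rightarrow> P' \<and>
        (\<forall>v. subst P' (\<sigma>(w' := v)) = (Par X' Y)\<lbrace>v/w\<rbrace>)"
      using a'(2) fr
    proof eventually_elim
      case (elim w')
      then obtain P' where "D \<turnstile> P \<midarrow>K a' w'\<rightarrow> P'" "\<forall>v. subst P' (\<sigma>(w' := v)) = X'\<lbrace>v/w\<rbrace>" by blast
      then show ?case
        using par_left[of D P "K a' w'" P' Q] elim(2) rest Bound(1)
        by (intro exI[of _ "Par P' Q"]) auto
    qed
    moreover have "\<forall>\<^sub>F w' in cofinite. \<exists>P'. D \<turnstile> Par Q P \<midarrow>K a' w'\<rightarrow> P' \<and>
        (\<forall>v. subst P' (\<sigma>(w' := v)) = (Par Y X')\<lbrace>v/w\<rbrace>)"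
      using a'(2) fr
    proof eventually_elim
      case (elim w')
      then obtain P' where "D \<turnstile> P \<midarrow>K a' w'\<rightarrow> P'" "\<forall>v. subst P' (\<sigma>(w' := v)) = X'\<lbrace>v/w\<rbrace>" by blast
      then show ?case
        using par_right[of D P "K a' w'" P' Q] elim(2) rest Bound(1)
        by (intro exI[of _ "Par Q P'"]) auto
    qed
    ultimately show ?thesis
      using a'(1) unfolding reflects_K[OF Bound(1)] Bound(2) reflects_bound_def by blast
  qed
  then show "reflects \<sigma> (Par P Q) \<alpha> (Par X' Y)" "reflects \<sigma> (Par Q P) \<alpha> (Par Y X')" by auto
qed

text \<open>A free name of an action of \<open>P\<close> whose image avoids \<open>y\<close> cannot
  be \<open>x\<close>, because \<open>x\<close> is sent to \<open>y\<close>; hence the side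
  condition of \<open>res\<close> transfers back. Freshness of \<open>y\<close> for the other free
  names lets the bodies be rebound.\<close>

lemma reflects_Res:
  assumes "reflects (\<sigma>(x := y)) P \<alpha> X'" "y \<notin> names \<alpha>" "y \<notin> \<sigma> ` (fn P - {x})"
  shows "reflects \<sigma> (Res x P) \<alpha> (Res y X')"
proof (cases \<alpha> rule: act_cases)
  case Tau
  then obtain P' where P': "D \<turnstile> P \<midarrow>TauA\<rightarrow> P'" "subst P' (\<sigma>(x := y)) = subst X' id"
    using assms(1) by auto
  have "subst (Res x P') \<sigma> = subst (Res y X') id"
    by (rule subst_Res_eqI[where v = y]) (use P'(2) fn_step[OF P'(1)] assms(3) in \<open>auto simp: subst_same simp del: fun_upd_triv\<close>)
  then show ?thesis
    using Tau res[OF P'(1), of x] by auto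
next
  case (Out a b)
  then obtain a' b' P' where P': "D \<turnstile> P \<midarrow>OutA a' b'\<rightarrow> P'" "subst P' (\<sigma>(x := y)) = subst X' id"
    and ab: "(\<sigma>(x := y)) a' = a" "(\<sigma>(x := y)) b' = b"
    using assms(1) by auto
  have "a' \<noteq> x" "b' \<noteq> x"
    using ab assms(2) Out by auto
  moreover have "subst (Res x P') \<sigma> = subst (Res y X') id"
    by (rule subst_Res_eqI[where v = y]) (use P'(2) fn_step[OF P'(1)] assms(3) in \<open>auto simp: subst_same simp del: fun_upd_triv\<close>)
  ultimately show ?thesis
    using Out ab res[OF P'(1), of x] by (auto simp del: subst.simps)
next
  case (Bound K a w)
  then obtain a' where a': "(\<sigma>(x := y)) a' = a"
    "\<forall>\<^sub>F w' in cofinite. \<exists>P'. D \<turnstile> P \<midarrow>K a' w'\<rightarrow> P' \<and> (\<forall>v. subst P' (\<sigma>(x := y, w' := v)) = X'\<lbrace>v/w\<rbrace>)"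
    using assms(1) unfolding reflects_K[OF Bound(1)] Bound(2) reflects_bound_def by blast
  have "a' \<noteq> x" and w: "w \<noteq> y"
    using a'(1) assms(2) Bound by auto
  have "\<forall>\<^sub>F w' in cofinite. w' \<notin> {x}"
    by (rule cofinite_notin) simp
  with a'(2) have "\<forall>\<^sub>F w' in cofinite. \<exists>P'. D \<turnstile> Res x P \<midarrow>K a' w'\<rightarrow> P' \<and>
      (\<forall>v. subst P' (\<sigma>(w' := v)) = (Res y X')\<lbrace>v/w\<rbrace>)"
  proof eventually_elim
    case (elim w')
    then obtain P' where P': "D \<turnstile> P \<midarrow>K a' w'\<rightarrow> P'"
      and eq: "\<And>v. subst P' (\<sigma>(x := y, w' := v)) = X'\<lbrace>v/w\<rbrace>" by blast
    have fnP': "fn P' \<subseteq> insert w' (fn P)"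
      using fn_step[OF P'] Bound(1) by simp
    have "subst (Res x P') (\<sigma>(w' := v)) = (Res y X')\<lbrace>v/w\<rbrace>" for v
      unfolding subst_Res_eq_iff
    proof
      fix u
      have "finite ({y} \<union> \<sigma> ` fn P' \<union> fn X')" by simp
      then obtain v' where v': "v' \<notin> {y} \<union> \<sigma> ` fn P' \<union> fn X'"
        by (rule ex_fresh)
      have "subst P' (\<sigma>(w' := v, x := u)) = subst (subst P' (\<sigma>(x := y, w' := v'))) (id(v' := v, y := u))"
        unfolding subst_comp
      proof (rule subst_cong)
        fix n assume n: "n \<in> fn P'"
        then have "\<sigma> n \<noteq> v'" "n \<noteq> x \<Longrightarrow> n \<noteq> w' \<Longrightarrow> \<sigma> n \<noteq> y"
          using v' fnP' assms(3) by auto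
        then show "(\<sigma>(w' := v, x := u)) n = (id(v' := v, y := u) \<circ> \<sigma>(x := y, w' := v')) n"
          using v' elim(2) by auto
      qed
      also have "\<dots> = subst (X'\<lbrace>v'/w\<rbrace>) (id(v' := v, y := u))"
        by (simp only: eq)
      also have "\<dots> = subst X' (id(w := v, y := u))"
        unfolding subst_comp by (rule subst_cong) (use v' w in auto)
      finally show "subst P' (\<sigma>(w' := v, x := u)) = subst X' (id(w := v, y := u))" .
    qed
    then show ?case
      using res[OF P', of x] elim(2) Bound(1) \<open>a' \<noteq> x\<close> by (intro exI[of _ "Res x P'"]) auto
  qed
  then show ?thesis
    using a'(1) \<open>a' \<noteq> x\<close> unfolding reflects_K[OF Bound(1)] Bound(2) reflects_bound_def by auto
qed

section \<open>Inversion of equations between substituted terms\<close>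

lemma subst_eq_TauE:
  assumes "subst P \<sigma> = subst (Tau X) \<tau>"
  obtains P0 where "P = Tau P0" "subst P0 \<sigma> = subst X \<tau>"
  using assms by (cases P) (auto simp: Let_def)

lemma subst_eq_OutE:
  assumes "subst P \<sigma> = subst (Out a b X) \<tau>"
  obtains a' b' P0 where "P = Out a' b' P0" "\<sigma> a' = \<tau> a" "\<sigma> b' = \<tau> b" "subst P0 \<sigma> = subst X \<tau>"
  using assms by (cases P) (auto simp: Let_def)

lemma subst_eq_ParE:
  assumes "subst P \<sigma> = subst (Par X Y) \<tau>"
  obtains P1 P2 where "P = Par P1 P2" "subst P1 \<sigma> = subst X \<tau>" "subst P2 \<sigma> = subst Y \<tau>"
  using assms by (cases P) (auto simp: Let_def)

lemma subst_eq_SumE: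
  assumes "subst P \<sigma> = subst (Sum X Y) \<tau>"
  obtains P1 P2 where "P = Sum P1 P2" "subst P1 \<sigma> = subst X \<tau>" "subst P2 \<sigma> = subst Y \<tau>"
  using assms by (cases P) (auto simp: Let_def)

lemma subst_eq_ResE:
  assumes "subst P \<sigma> = subst (Res y X) id"
  obtains x P0 where "P = Res x P0" "\<And>v. subst P0 (\<sigma>(x := v)) = X\<lbrace>v/y\<rbrace>"
    "subst P0 (\<sigma>(x := y)) = subst X id" "y \<notin> \<sigma> ` (fn P0 - {x})"
proof -
  obtain x P0 where P: "P = Res x P0"
    using assms by (cases P) (auto simp: Let_def)
  have eq: "subst P0 (\<sigma>(x := v)) = X\<lbrace>v/y\<rbrace>" for v
    using assms unfolding P subst_Res_eq_iff by blast
  have "subst P0 (\<sigma>(x := y)) = subst X id"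
    unfolding eq by (rule subst_same)
  moreover have "\<sigma> ` (fn P0 - {x}) = fn X - {y}"
    using arg_cong[OF assms, of fn] by (simp add: fn_subst P del: subst.simps)
  ultimately show ?thesis
    using that[OF P eq] by blast
qed

lemma subst_eq_InE:
  assumes "subst P \<sigma> = subst (In a y X) id"
  obtains b x P0 where "P = In b x P0" "\<sigma> b = a" "\<And>v. subst P0 (\<sigma>(x := v)) = X\<lbrace>v/y\<rbrace>"
proof -
  obtain b x P0 where P: "P = In b x P0"
    using assms by (cases P) (auto simp: Let_def)
  show ?thesis
    using assms that[OF P] unfolding P subst_In_eq_iff by auto
qed

lemma subst_bound_instance:
  assumes "\<And>v. subst P (\<sigma>(w' := v)) = X\<lbrace>v/w\<rbrace>"
  shows "subst (P\<lbrace>b/w'\<rbrace>) \<sigma> = subst (X\<lbrace>\<sigma> b/w\<rbrace>) id"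
proof -
  have "\<sigma> \<circ> id(w' := b) = \<sigma>(w' := \<sigma> b)" by auto
  then show ?thesis
    using assms[of "\<sigma> b"] by (simp add: subst_comp)
qed

text \<open>Induction on the derivation also covers unguarded recursion. A clash can originate only
  in the four synchronisation rules: the two reflected subjects have the same image, and if they
  differ, both are free and one carries a barb. All other rules merely propagate it. Taking any
  \<alpha>-variant \<open>X\<close> of \<open>subst P \<sigma>\<close> makes the statement iterable,
  since derivatives match only up to \<alpha>-conversion.\<close>

lemma step_reflect:
  "D \<turnstile> X \<midarrow>\<alpha>\<rightarrow> X' \<Longrightarrow> subst P \<sigma> = subst X id \<Longrightarrow> clash P \<sigma> \<or> reflects \<sigma> P \<alpha> X'"
proof (induction arbitrary: P \<sigma> rule: step.induct)
  case (tau_act X)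
  then obtain P0 where "P = Tau P0" "subst P0 \<sigma> = subst X id"
    by (rule subst_eq_TauE)
  then show ?case
    using step.tau_act by auto
next
  case (output_act a b X)
  then obtain a' b' P0 where "P = Out a' b' P0" "\<sigma> a' = a" "\<sigma> b' = b" "subst P0 \<sigma> = subst X id"
    by (metis subst_eq_OutE id_apply)
  then show ?case
    unfolding reflects.simps using step.output_act by blast
next
  case (input_act w z X a)
  from input_act(2) obtain b x P0 where P: "P = In b x P0" "\<sigma> b = a"
    and eq: "\<And>v. subst P0 (\<sigma>(x := v)) = X\<lbrace>v/z\<rbrace>"
    by (rule subst_eq_InE) blast
  have "\<forall>\<^sub>F w' in cofinite. w' \<notin> fn (Res x P0)"
    by (rule cofinite_notin) simp
  then have "\<forall>\<^sub>F w' in cofinite. \<exists>P'. D \<turnstile> P \<midarrow>InA b w'\<rightarrow> P' \<and>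
      (\<forall>v. subst P' (\<sigma>(w' := v)) = (X\<lbrace>w/z\<rbrace>)\<lbrace>v/w\<rbrace>)"
  proof eventually_elim
    case (elim w')
    have "subst (P0\<lbrace>w'/x\<rbrace>) (\<sigma>(w' := v)) = (X\<lbrace>w/z\<rbrace>)\<lbrace>v/w\<rbrace>" for v
      using subst_rebind[of w' id P0 x \<sigma> v] subst_rebind1[of w X z v] elim input_act(1) eq by simp
    then show ?case
      using step.input_act[OF elim] P(1) by blast
  qed
  then show ?case
    using P(2) by (auto simp: reflects_bound_def)
next
  case (sum_left X \<alpha> X' Y)
  then obtain P1 P2 where P: "P = Sum P1 P2" "subst P1 \<sigma> = subst X id"
    by (blast elim: subst_eq_SumE)
  then show ?case
    using sum_left.IH[of P1 \<sigma>] clash_mono[of P1 P \<sigma>] reflects_mono[of P1 P \<sigma> \<alpha> X'] step.sum_left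
    by (metis Un_upper1 fn.simps(7))
next
  case (sum_right X \<alpha> X' Y)
  then obtain P1 P2 where P: "P = Sum P2 P1" "subst P1 \<sigma> = subst X id"
    by (blast elim: subst_eq_SumE)
  then show ?case
    using sum_right.IH[of P1 \<sigma>] clash_mono[of P1 P \<sigma>] reflects_mono[of P1 P \<sigma> \<alpha> X'] step.sum_right
    by (metis Un_upper2 fn.simps(7))
next
  case (ide A xs B ys \<alpha> X')
  then obtain zs where P: "P = Ident A zs" "map \<sigma> zs = ys"
    by (cases P) (auto simp: Let_def)
  let ?B = "subst B (list_map xs zs)"
  have len: "length zs = length xs"
    using P(2) ide(2) by auto
  have "subst ?B \<sigma> = subst (subst B (list_map xs ys)) id"
    using subst_body[OF ide(1) len] subst_body[OF ide(1,2)] P(2) by simp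
  then have "clash ?B \<sigma> \<or> reflects \<sigma> ?B \<alpha> X'"
    by (rule ide.IH)
  moreover have "\<And>\<alpha> P'. D \<turnstile> ?B \<midarrow>\<alpha>\<rightarrow> P' \<Longrightarrow> D \<turnstile> P \<midarrow>\<alpha>\<rightarrow> P'"
    unfolding P(1) using step.ide[of D A xs B zs] ide(1) len by blast
  moreover have "fn ?B \<subseteq> fn P"
    using fn_body[OF ide(1) len] P(1) by simp
  ultimately show ?case
    using clash_mono[of ?B P] reflects_mono[of ?B P] by blast
next
  case (par_left X \<alpha> X' Y)
  from par_left(4) obtain P1 P2 where P: "P = Par P1 P2" "subst P1 \<sigma> = subst X id" "subst P2 \<sigma> = subst Y id"
    by (rule subst_eq_ParE)
  then show ?case
    using par_left.IH[of P1 \<sigma>] clash_Par_left reflects_Par(1) par_left(2) by blast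
next
  case (par_right X \<alpha> X' Y)
  from par_right(4) obtain P1 P2 where P: "P = Par P2 P1" "subst P1 \<sigma> = subst X id" "subst P2 \<sigma> = subst Y id"
    by (rule subst_eq_ParE)
  then show ?case
    using par_right.IH[of P1 \<sigma>] clash_Par_right reflects_Par(2) par_right(2) by blast
next
  case (com_left X a b X' Y z Y')
  from com_left(5) obtain P1 P2 where P: "P = Par P1 P2" "subst P1 \<sigma> = subst X id" "subst P2 \<sigma> = subst Y id"
    by (rule subst_eq_ParE)
  show ?case
  proof (cases "clash P \<sigma>")
    case False
    have "reflects \<sigma> P1 (OutA a b) X'" "reflects_bound InA \<sigma> P2 a z Y'"
      using com_left.IH(1)[OF P(2)] com_left.IH(2)[OF P(3)] False clash_Par_left clash_Par_right P(1) by auto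
    then obtain a' b' P1' a'' where P1': "D \<turnstile> P1 \<midarrow>OutA a' b'\<rightarrow> P1'"
        "\<sigma> a' = a" "\<sigma> b' = b" "subst P1' \<sigma> = subst X' id"
      and a'': "\<sigma> a'' = a" "a'' \<in> fn P2" "barb P2 a''"
        "\<forall>\<^sub>F w in cofinite. \<exists>P'. D \<turnstile> P2 \<midarrow>InA a'' w\<rightarrow> P' \<and> (\<forall>v. subst P' (\<sigma>(w := v)) = Y'\<lbrace>v/z\<rbrace>)"
      by (auto elim: reflects_boundE)
    have "a' \<in> fn P1"
      using subject_in_fn[OF P1'(1)] by simp
    then have "a' = a''"
      using clash_Par_subjects(2)[of P2 a'' a' P1 \<sigma>] a'' P1'(2) False P(1) by auto
    moreover obtain w P2' where P2': "D \<turnstile> P2 \<midarrow>InA a'' w\<rightarrow> P2'"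
        "\<And>v. subst P2' (\<sigma>(w := v)) = Y'\<lbrace>v/z\<rbrace>"
      using ex_cofinite[OF a''(4)] by blast
    ultimately have "D \<turnstile> P \<midarrow>TauA\<rightarrow> Par P1' (P2'\<lbrace>b'/w\<rbrace>)"
      using step.com_left[of D P1 a'] P1' P2'(1) P(1) by blast
    moreover have "subst (P2'\<lbrace>b'/w\<rbrace>) \<sigma> = subst (Y'\<lbrace>b/z\<rbrace>) id"
      using subst_bound_instance[OF P2'(2)] P1'(3) by simp
    ultimately show ?thesis
      using P1'(4) by (intro disjI2) (auto intro!: exI[of _ "Par P1' (P2'\<lbrace>b'/w\<rbrace>)"])
  qed simp
next
  case (com_right X a z X' Y b Y')
  from com_right(5) obtain P1 P2 where P: "P = Par P1 P2" "subst P1 \<sigma> = subst X id" "subst P2 \<sigma> = subst Y id"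
    by (rule subst_eq_ParE)
  show ?case
  proof (cases "clash P \<sigma>")
    case False
    have "reflects \<sigma> P2 (OutA a b) Y'" "reflects_bound InA \<sigma> P1 a z X'"
      using com_right.IH(1)[OF P(2)] com_right.IH(2)[OF P(3)] False clash_Par_left clash_Par_right P(1) by auto
    then obtain a' b' P2' a'' where P2': "D \<turnstile> P2 \<midarrow>OutA a' b'\<rightarrow> P2'"
        "\<sigma> a' = a" "\<sigma> b' = b" "subst P2' \<sigma> = subst Y' id"
      and a'': "\<sigma> a'' = a" "a'' \<in> fn P1" "barb P1 a''"
        "\<forall>\<^sub>F w in cofinite. \<exists>P'. D \<turnstile> P1 \<midarrow>InA a'' w\<rightarrow> P' \<and> (\<forall>v. subst P' (\<sigma>(w := v)) = X'\<lbrace>v/z\<rbrace>)"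
      by (auto elim: reflects_boundE)
    have "a' \<in> fn P2"
      using subject_in_fn[OF P2'(1)] by simp
    then have "a' = a''"
      using clash_Par_subjects(1)[of P1 a'' a' P2 \<sigma>] a'' P2'(2) False P(1) by auto
    moreover obtain w P1' where P1': "D \<turnstile> P1 \<midarrow>InA a'' w\<rightarrow> P1'"
        "\<And>v. subst P1' (\<sigma>(w := v)) = X'\<lbrace>v/z\<rbrace>"
      using ex_cofinite[OF a''(4)] by blast
    ultimately have "D \<turnstile> P \<midarrow>TauA\<rightarrow> Par (P1'\<lbrace>b'/w\<rbrace>) P2'"
      using step.com_right[of D P1 a'] P1' P2'(1) P(1) by blast
    moreover have "subst (P1'\<lbrace>b'/w\<rbrace>) \<sigma> = subst (X'\<lbrace>b/z\<rbrace>) id"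
      using subst_bound_instance[OF P1'(2)] P2'(3) by simp
    ultimately show ?thesis
      using P2'(4) by (intro disjI2) (auto intro!: exI[of _ "Par (P1'\<lbrace>b'/w\<rbrace>) P2'"])
  qed simp
next
  case (close_left X a w X' Y Y')
  from close_left(5) obtain P1 P2 where P: "P = Par P1 P2" "subst P1 \<sigma> = subst X id" "subst P2 \<sigma> = subst Y id"
    by (rule subst_eq_ParE)
  show ?case
  proof (cases "clash P \<sigma>")
    case False
    have "reflects_bound BOutA \<sigma> P1 a w X'" "reflects_bound InA \<sigma> P2 a w Y'"
      using close_left.IH(1)[OF P(2)] close_left.IH(2)[OF P(3)] False clash_Par_left clash_Par_right P(1) by auto
    then obtain a' a'' where a': "\<sigma> a' = a" "a' \<in> fn P1" "barb P1 a'"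
        "\<forall>\<^sub>F z in cofinite. \<exists>P'. D \<turnstile> P1 \<midarrow>BOutA a' z\<rightarrow> P' \<and> (\<forall>v. subst P' (\<sigma>(z := v)) = X'\<lbrace>v/w\<rbrace>)"
      and a'': "\<sigma> a'' = a" "a'' \<in> fn P2"
        "\<forall>\<^sub>F z in cofinite. \<exists>P'. D \<turnstile> P2 \<midarrow>InA a'' z\<rightarrow> P' \<and> (\<forall>v. subst P' (\<sigma>(z := v)) = Y'\<lbrace>v/w\<rbrace>)"
      by (auto elim!: reflects_boundE)
    have "a' = a''"
      using clash_Par_subjects(1)[of P1 a' a'' P2 \<sigma>] a' a''(1,2) False P(1) by auto
    \<comment> \<open>The rule \<open>close_left\<close> demands one bound name for both components;
      each of them allows all but finitely many, so a common one exists.\<close>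
    moreover obtain z P1' P2' where P': "D \<turnstile> P1 \<midarrow>BOutA a' z\<rightarrow> P1'" "D \<turnstile> P2 \<midarrow>InA a'' z\<rightarrow> P2'"
        "\<And>v. subst P1' (\<sigma>(z := v)) = X'\<lbrace>v/w\<rbrace>" "\<And>v. subst P2' (\<sigma>(z := v)) = Y'\<lbrace>v/w\<rbrace>"
      using ex_cofinite[OF eventually_conj[OF a'(4) a''(3)]] by blast
    ultimately have "D \<turnstile> P \<midarrow>TauA\<rightarrow> Res z (Par P1' P2')"
      using step.close_left[of D P1 a' z P1' P2 P2'] P(1) by simp
    moreover have "subst (Res z (Par P1' P2')) \<sigma> = subst (Res w (Par X' Y')) id"
      unfolding subst_Res_eq_iff using P'(3,4) by simp
    ultimately show ?thesis
      by (intro disjI2) (auto simp del: subst.simps)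
  qed simp
next
  case (close_right X a w X' Y Y')
  from close_right(5) obtain P1 P2 where P: "P = Par P1 P2" "subst P1 \<sigma> = subst X id" "subst P2 \<sigma> = subst Y id"
    by (rule subst_eq_ParE)
  show ?case
  proof (cases "clash P \<sigma>")
    case False
    have "reflects_bound InA \<sigma> P1 a w X'" "reflects_bound BOutA \<sigma> P2 a w Y'"
      using close_right.IH(1)[OF P(2)] close_right.IH(2)[OF P(3)] False clash_Par_left clash_Par_right P(1) by auto
    then obtain a' a'' where a': "\<sigma> a' = a" "a' \<in> fn P1" "barb P1 a'"
        "\<forall>\<^sub>F z in cofinite. \<exists>P'. D \<turnstile> P1 \<midarrow>InA a' z\<rightarrow> P' \<and> (\<forall>v. subst P' (\<sigma>(z := v)) = X'\<lbrace>v/w\<rbrace>)"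
      and a'': "\<sigma> a'' = a" "a'' \<in> fn P2"
        "\<forall>\<^sub>F z in cofinite. \<exists>P'. D \<turnstile> P2 \<midarrow>BOutA a'' z\<rightarrow> P' \<and> (\<forall>v. subst P' (\<sigma>(z := v)) = Y'\<lbrace>v/w\<rbrace>)"
      by (auto elim!: reflects_boundE)
    have "a' = a''"
      using clash_Par_subjects(1)[of P1 a' a'' P2 \<sigma>] a' a''(1,2) False P(1) by auto
    moreover obtain z P1' P2' where P': "D \<turnstile> P1 \<midarrow>InA a' z\<rightarrow> P1'" "D \<turnstile> P2 \<midarrow>BOutA a'' z\<rightarrow> P2'"
        "\<And>v. subst P1' (\<sigma>(z := v)) = X'\<lbrace>v/w\<rbrace>" "\<And>v. subst P2' (\<sigma>(z := v)) = Y'\<lbrace>v/w\<rbrace>"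
      using ex_cofinite[OF eventually_conj[OF a'(4) a''(3)]] by blast
    ultimately have "D \<turnstile> P \<midarrow>TauA\<rightarrow> Res z (Par P1' P2')"
      using step.close_right[of D P1 a' z P1' P2 P2'] P(1) by simp
    moreover have "subst (Res z (Par P1' P2')) \<sigma> = subst (Res w (Par X' Y')) id"
      unfolding subst_Res_eq_iff using P'(3,4) by simp
    ultimately show ?thesis
      by (intro disjI2) (auto simp del: subst.simps)
  qed simp
next
  case (res X \<alpha> X' y)
  from res(4) obtain x P0 where P: "P = Res x P0" "subst P0 (\<sigma>(x := y)) = subst X id"
      "y \<notin> \<sigma> ` (fn P0 - {x})"
    by (rule subst_eq_ResE)
  then show ?case
    using res.IH[OF P(2)] clash_Res[OF _ P(3)] reflects_Res[OF _ res(2) P(3)] by blast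
next
  case (open_scope X a y X' w)
  from open_scope(5) obtain x P0 where P: "P = Res x P0" "subst P0 (\<sigma>(x := y)) = subst X id"
      "y \<notin> \<sigma> ` (fn P0 - {x})"
    by (rule subst_eq_ResE)
  show ?case
  proof (cases "clash P \<sigma>")
    case False
    then have "reflects (\<sigma>(x := y)) P0 (OutA a y) X'"
      using open_scope.IH[OF P(2)] clash_Res[OF _ P(3)] P(1) by blast
    then obtain a' b' P0' where P0': "D \<turnstile> P0 \<midarrow>OutA a' b'\<rightarrow> P0'" "subst P0' (\<sigma>(x := y)) = subst X' id"
      and ab: "(\<sigma>(x := y)) a' = a" "(\<sigma>(x := y)) b' = y"
      by auto
    have a': "a' \<noteq> x" "\<sigma> a' = a"
      using ab(1) open_scope(2) by auto
    have "b' \<in> fn P0"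
      using subject_in_fn[OF P0'(1)] by simp
    \<comment> \<open>No free name of \<open>P0\<close> other than \<open>x\<close> is mapped to
      \<open>y\<close>.\<close>
    then have "b' = x"
      using ab(2) P(3) by (auto split: if_splits)
    have y: "y \<notin> \<sigma> ` (fn P0' - {x})"
      using fn_step[OF P0'(1)] P(3) by auto
    have eq: "subst P0' (\<sigma>(x := v)) = X'\<lbrace>v/y\<rbrace>" for v
      using subst_rebind[OF y, of id v] P0'(2) by (simp add: subst_comp)
    have "\<forall>\<^sub>F w' in cofinite. w' \<notin> fn (Res x P0')"
      by (rule cofinite_notin) simp
    then have "\<forall>\<^sub>F w' in cofinite. \<exists>P'. D \<turnstile> P \<midarrow>BOutA a' w'\<rightarrow> P' \<and>
        (\<forall>v. subst P' (\<sigma>(w' := v)) = (X'\<lbrace>w/y\<rbrace>)\<lbrace>v/w\<rbrace>)"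
    proof eventually_elim
      case (elim w')
      have "subst (P0'\<lbrace>w'/x\<rbrace>) (\<sigma>(w' := v)) = (X'\<lbrace>w/y\<rbrace>)\<lbrace>v/w\<rbrace>" for v
        using subst_rebind[of w' id P0' x \<sigma> v] subst_rebind1[of w X' y v] elim open_scope(3) eq by simp
      then show ?case
        using step.open_scope[of D P0 a' x P0' w'] P0'(1) \<open>b' = x\<close> a'(1) elim P(1) by blast
    qed
    then show ?thesis
      using a'(2) by (auto simp: reflects_bound_def)
  qed simp
qed

text \<open>Injectivity on the free names rules out a clash even for visible processes.\<close>

lemma reflects_injective:
  assumes "D \<turnstile> X \<midarrow>\<alpha>\<rightarrow> X'" "subst P \<sigma> = subst X id" "inj_on \<sigma> (fn P)"
  shows "reflects \<sigma> P \<alpha> X'"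
  using step_reflect[OF assms(1,2)] assms(3) unfolding clash_def inj_on_def by blast

section \<open>Weak visibility and its behaviour under substitution\<close>

lemma weakly_visible_step:
  "D \<turnstile> P \<midarrow>\<alpha>\<rightarrow> P' \<Longrightarrow> \<alpha> \<noteq> TauA \<Longrightarrow> D \<turnstile> P\<Down>"
  unfolding weakly_visible_def visible_def tau_steps_def by blast

lemma weakly_visible_tau:
  "D \<turnstile> P \<midarrow>TauA\<rightarrow> P' \<Longrightarrow> D \<turnstile> P'\<Down> \<Longrightarrow> D \<turnstile> P\<Down>"
  unfolding weakly_visible_def tau_steps_def by (blast intro: converse_rtranclp_into_rtranclp)

lemma weakly_visible_induct [consumes 1, case_names step tau]:
  assumes "D \<turnstile> P\<Down>"
    and "\<And>P \<alpha> P'. D \<turnstile> P \<midarrow>\<alpha>\<rightarrow> P' \<Longrightarrow> \<alpha> \<noteq> TauA \<Longrightarrow> R P"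
    and "\<And>P P'. D \<turnstile> P \<midarrow>TauA\<rightarrow> P' \<Longrightarrow> R P' \<Longrightarrow> R P"
  shows "R P"
proof -
  obtain Q \<alpha> Q' where "(\<lambda>Q Q'. D \<turnstile> Q \<midarrow>TauA\<rightarrow> Q')\<^sup>*\<^sup>* P Q" "D \<turnstile> Q \<midarrow>\<alpha>\<rightarrow> Q'" "\<alpha> \<noteq> TauA"
    using assms(1) unfolding weakly_visible_def visible_def tau_steps_def by blast
  then show ?thesis
    by (induction rule: converse_rtranclp_induct) (blast intro: assms(2,3))+
qed

lemma barb_weakly_visible: "barb P c \<Longrightarrow> D \<turnstile> P\<Down>"
  unfolding barb_def by (auto dest!: ex_cofinite intro: weakly_visible_step)

lemma reflects_weakly_visible:
  assumes "reflects \<sigma> P \<alpha> X'" "\<alpha> \<noteq> TauA"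
  shows "D \<turnstile> P\<Down>"
  using assms
  by (cases \<alpha>) (auto simp: reflects_bound_def dest!: ex_cofinite intro: weakly_visible_step)

text \<open>Along the silent path of \<open>X\<close>, every step is reflected by \<open>P\<close>
  until a clash occurs or the visible action is reached. A clash ends the argument at once, since it
  contains a barb of the current descendant of \<open>P\<close>.\<close>

lemma weakly_visible_subst:
  assumes "D \<turnstile> X\<Down>" "subst P \<sigma> = subst X id"
  shows "D \<turnstile> P\<Down>"
  using assms
proof (induction arbitrary: P rule: weakly_visible_induct)
  case (step X \<alpha> X')
  then show ?case
    using step_reflect[OF step(1,3)] reflects_weakly_visible barb_weakly_visible
    unfolding clash_def by blast
next
  case (tau X X')
  then show ?case
    using step_reflect[OF tau(1,3)] barb_weakly_visible weakly_visible_tau tau.IH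
    unfolding clash_def reflects.simps(1) by blast
qed

lemma invisible_subst: "invisible D P \<Longrightarrow> invisible D (subst P \<sigma>)"
  using weakly_visible_subst[of "subst P \<sigma>" P \<sigma>] unfolding invisible_def by (auto simp: subst_comp)

lemma invisible_step:
  assumes "invisible D P" "D \<turnstile> P \<midarrow>\<alpha>\<rightarrow> P'"
  shows "\<alpha> = TauA" "invisible D P'"
  using assms weakly_visible_step weakly_visible_tau unfolding invisible_def by blast+

subsection \<open>Replacing invisible subterms\<close>

inductive below :: "'k proc \<Rightarrow> 'k proc \<Rightarrow> bool" where
  below_refl: "below Q Q"
| below_Sum_left: "below Q Q1 \<Longrightarrow> below Q (Sum Q1 Q2)"
| below_Sum_right: "below Q Q2 \<Longrightarrow> below Q (Sum Q1 Q2)"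
| below_Ident: "D A = (xs, B) \<Longrightarrow> length ys = length xs \<Longrightarrow> below Q (subst B (list_map xs ys))
    \<Longrightarrow> below Q (Ident A ys)"

lemma below_trans: "below Q R \<Longrightarrow> below P Q \<Longrightarrow> below P R"
  by (induction rule: below.induct) (auto intro: below.intros)

text \<open>The rules for sums and identifiers pass on the action and the derivative of their
  premise unchanged, and \<open>below\<close> crosses no other operator.\<close>

lemma below_step: "below Q R \<Longrightarrow> D \<turnstile> Q \<midarrow>\<alpha>\<rightarrow> Q' \<Longrightarrow> D \<turnstile> R \<midarrow>\<alpha>\<rightarrow> Q'"
  by (induction rule: below.induct) (auto intro: step.sum_left step.sum_right step.ide)

lemma below_subst: "below Q R \<Longrightarrow> below (subst Q \<tau>) (subst R \<tau>)"
proof (induction rule: below.induct)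
  case (below_Ident A xs B ys Q)
  then show ?case
    using below.below_Ident[of A xs B "map \<tau> ys"] by (simp add: subst_body)
qed (simp_all add: below.intros)

text \<open>
  \<open>related P \<sigma> Q\<close>: up to \<alpha>-conversion, \<open>Q\<close> is \<open>subst P \<sigma>\<close> with invisible subterms replaced
  arbitrarily. Since a replaced subterm need not match the silent steps of the original, \<open>Q\<close> may fail
  to resolve a choice or unfold an identifier that the original has resolved or unfolded;
  this is what \<open>below\<close> is for.
\<close>

primrec related :: "'k proc \<Rightarrow> (name \<Rightarrow> name) \<Rightarrow> 'k proc \<Rightarrow> bool" where
  "related Null \<sigma> Q \<longleftrightarrow> True"
| "related (Tau P) \<sigma> Q \<longleftrightarrow> invisible D (Tau P) \<or> (\<exists>Q1. below (Tau Q1) Q \<and> related P \<sigma> Q1)"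
| "related (Out a b P) \<sigma> Q \<longleftrightarrow> invisible D (Out a b P) \<or>
     (\<exists>Q1. below (Out (\<sigma> a) (\<sigma> b) Q1) Q \<and> related P \<sigma> Q1)"
| "related (In a x P) \<sigma> Q \<longleftrightarrow> invisible D (In a x P) \<or>
     (\<exists>y Q1. below (In (\<sigma> a) y Q1) Q \<and> (\<forall>v. related P (\<sigma>(x := v)) (Q1\<lbrace>v/y\<rbrace>)))"
| "related (Res x P) \<sigma> Q \<longleftrightarrow> invisible D (Res x P) \<or>
     (\<exists>y Q1. below (Res y Q1) Q \<and> (\<forall>v. related P (\<sigma>(x := v)) (Q1\<lbrace>v/y\<rbrace>)))"
| "related (Par P1 P2) \<sigma> Q \<longleftrightarrow> invisible D (Par P1 P2) \<or>
     (\<exists>Q1 Q2. below (Par Q1 Q2) Q \<and> related P1 \<sigma> Q1 \<and> related P2 \<sigma> Q2)"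
| "related (Sum P1 P2) \<sigma> Q \<longleftrightarrow> invisible D (Sum P1 P2) \<or>
     (\<exists>Q1 Q2. below (Sum Q1 Q2) Q \<and> related P1 \<sigma> Q1 \<and> related P2 \<sigma> Q2)"
| "related (Ident A ys) \<sigma> Q \<longleftrightarrow> invisible D (Ident A ys) \<or> below (Ident A (map \<sigma> ys)) Q"

section \<open>Closure properties of the relation\<close>

lemma related_invisible: "invisible D P \<Longrightarrow> related P \<sigma> Q"
  by (cases P) auto

lemma related_In_below:
  assumes "below (In b y Q1) Q" "\<sigma> a = b" "\<And>v. related P (\<sigma>(x := v)) (Q1\<lbrace>v/y\<rbrace>)"
  shows "related (In a x P) \<sigma> Q"
  using assms by auto

lemma related_InE:
  assumes "related (In a x P) \<sigma> Q" "\<not> invisible D (In a x P)"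
  obtains b y Q1 where "\<sigma> a = b" "below (In b y Q1) Q" "\<And>v. related P (\<sigma>(x := v)) (Q1\<lbrace>v/y\<rbrace>)"
  using assms by auto

lemma related_ResE:
  assumes "related (Res x P) \<sigma> Q" "\<not> invisible D (Res x P)"
  obtains y Q1 where "below (Res y Q1) Q" "\<And>v. related P (\<sigma>(x := v)) (Q1\<lbrace>v/y\<rbrace>)"
  using assms by auto

lemma related_In:
  assumes "\<sigma> a = b" "\<And>v. related P (\<sigma>(x := v)) (Q\<lbrace>v/y\<rbrace>)"
  shows "related (In a x P) \<sigma> (In b y Q)"
  using related_In_below[of b y Q "In b y Q" \<sigma> a P x] assms below_refl by blast

lemma related_below: "related P \<sigma> Q \<Longrightarrow> below Q R \<Longrightarrow> related P \<sigma> R"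
  by (cases P) (auto, (metis below_trans)+)

lemma related_cong:
  "related P \<sigma> Q \<Longrightarrow> (\<And>n. n \<in> fn P \<Longrightarrow> \<sigma> n = \<tau> n) \<Longrightarrow> related P \<tau> Q"
proof (induction P arbitrary: \<sigma> \<tau> Q)
  case (Tau P)
  have "related P \<tau> Q'" if "related P \<sigma> Q'" for Q'
    by (rule Tau.IH[OF that]) (use Tau.prems in auto)
  then show ?case using Tau.prems(1) unfolding related.simps by blast
next
  case (Out a b P)
  have "related P \<tau> Q'" if "related P \<sigma> Q'" for Q'
    by (rule Out.IH[OF that]) (use Out.prems in auto)
  moreover have "\<sigma> a = \<tau> a" "\<sigma> b = \<tau> b" using Out.prems(2) by auto
  ultimately show ?case using Out.prems(1) unfolding related.simps by metis
next
  case (In a x P)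
  have "related P (\<tau>(x := v)) Q'" if "related P (\<sigma>(x := v)) Q'" for v Q'
    by (rule In.IH[OF that]) (use In.prems in auto)
  moreover have "\<sigma> a = \<tau> a" using In.prems(2) by auto
  ultimately show ?case using In.prems(1) unfolding related.simps by metis
next
  case (Res x P)
  have "related P (\<tau>(x := v)) Q'" if "related P (\<sigma>(x := v)) Q'" for v Q'
    by (rule Res.IH[OF that]) (use Res.prems in auto)
  then show ?case using Res.prems(1) unfolding related.simps by blast
next
  case (Par P1 P2)
  have "related P1 \<tau> Q'" if "related P1 \<sigma> Q'" for Q'
    by (rule Par.IH(1)[OF that]) (use Par.prems in auto)
  moreover have "related P2 \<tau> Q'" if "related P2 \<sigma> Q'" for Q'
    by (rule Par.IH(2)[OF that]) (use Par.prems in auto)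
  ultimately show ?case using Par.prems(1) unfolding related.simps by blast
next
  case (Sum P1 P2)
  have "related P1 \<tau> Q'" if "related P1 \<sigma> Q'" for Q'
    by (rule Sum.IH(1)[OF that]) (use Sum.prems in auto)
  moreover have "related P2 \<tau> Q'" if "related P2 \<sigma> Q'" for Q'
    by (rule Sum.IH(2)[OF that]) (use Sum.prems in auto)
  ultimately show ?case using Sum.prems(1) unfolding related.simps by blast
next
  case (Ident A ys)
  then have "map \<sigma> ys = map \<tau> ys" by auto
  then show ?case using Ident.prems(1) unfolding related.simps by metis
qed simp

text \<open>On the left only the environment changes, so every invisibility alternative carries over
  as it stands; on the right, \<open>below\<close> is stable under substitution.\<close>

lemma related_subst: "related P \<sigma> Q \<Longrightarrow> related P (\<tau> \<circ> \<sigma>) (subst Q \<tau>)"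
proof (induction P arbitrary: \<sigma> \<tau> Q)
  case Null
  then show ?case by simp
next
  case (Tau P)
  then show ?case
    unfolding related.simps using below_subst[of "Tau _" Q \<tau>] by fastforce
next
  case (Out a b P)
  then show ?case
    unfolding related.simps using below_subst[of "Out _ _ _" Q \<tau>] by fastforce
next
  case (In a x P)
  show ?case
  proof (cases "invisible D (In a x P)")
    case False
    then obtain y Q1 where Q1: "below (In (\<sigma> a) y Q1) Q" "\<And>v. related P (\<sigma>(x := v)) (Q1\<lbrace>v/y\<rbrace>)"
      using In.prems by auto
    have body: "related P ((\<tau> \<circ> \<sigma>)(x := v)) (subst Q1 (\<tau>(y := v)))" for v
    proof -
      have "finite (\<sigma> ` fn P \<union> fn Q1)" by simp
      then obtain u where u: "u \<notin> \<sigma> ` fn P \<union> fn Q1" by (rule ex_fresh)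
      have "related P (\<tau>(u := v) \<circ> \<sigma>(x := u)) (subst (Q1\<lbrace>u/y\<rbrace>) (\<tau>(u := v)))"
        by (rule In.IH) (rule Q1(2))
      moreover have "subst (Q1\<lbrace>u/y\<rbrace>) (\<tau>(u := v)) = subst Q1 (\<tau>(y := v))"
        using subst_rebind[of u id Q1 y \<tau> v] u by simp
      ultimately show ?thesis
        by (auto elim!: related_cong simp: u) (use u in auto)
    qed
    obtain y' where y': "y' \<notin> \<tau> ` (fn Q1 - {y})"
      "\<And>b. subst (In b y Q1) \<tau> = In (\<tau> b) y' (subst Q1 (\<tau>(y := y')))"
      using subst_Res_fresh[of \<tau> Q1 y] by metis
    have below: "below (In (\<tau> (\<sigma> a)) y' (subst Q1 (\<tau>(y := y')))) (subst Q \<tau>)"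
      using below_subst[OF Q1(1), of \<tau>] unfolding y'(2) .
    have rel: "related P ((\<tau> \<circ> \<sigma>)(x := v)) ((subst Q1 (\<tau>(y := y')))\<lbrace>v/y'\<rbrace>)" for v
      using body[of v] subst_rebind[OF y'(1), of id v] by simp
    show ?thesis by (rule related_In_below[OF below _ rel]) simp
  qed simp
next
  case (Res x P)
  show ?case
  proof (cases "invisible D (Res x P)")
    case False
    then obtain y Q1 where Q1: "below (Res y Q1) Q" "\<And>v. related P (\<sigma>(x := v)) (Q1\<lbrace>v/y\<rbrace>)"
      using Res.prems by auto
    have body: "related P ((\<tau> \<circ> \<sigma>)(x := v)) (subst Q1 (\<tau>(y := v)))" for v
    proof -
      have "finite (\<sigma> ` fn P \<union> fn Q1)" by simp
      then obtain u where u: "u \<notin> \<sigma> ` fn P \<union> fn Q1" by (rule ex_fresh)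
      have "related P (\<tau>(u := v) \<circ> \<sigma>(x := u)) (subst (Q1\<lbrace>u/y\<rbrace>) (\<tau>(u := v)))"
        by (rule Res.IH) (rule Q1(2))
      moreover have "subst (Q1\<lbrace>u/y\<rbrace>) (\<tau>(u := v)) = subst Q1 (\<tau>(y := v))"
        using subst_rebind[of u id Q1 y \<tau> v] u by simp
      ultimately show ?thesis
        by (auto elim!: related_cong simp: u) (use u in auto)
    qed
    obtain y' where y': "y' \<notin> \<tau> ` (fn Q1 - {y})"
      "subst (Res y Q1) \<tau> = Res y' (subst Q1 (\<tau>(y := y')))"
      using subst_Res_fresh[of \<tau> Q1 y] by metis
    have "below (Res y' (subst Q1 (\<tau>(y := y')))) (subst Q \<tau>)"
      using below_subst[OF Q1(1), of \<tau>] unfolding y'(2) .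
    moreover have "related P ((\<tau> \<circ> \<sigma>)(x := v)) ((subst Q1 (\<tau>(y := y')))\<lbrace>v/y'\<rbrace>)" for v
      using body[of v] subst_rebind[OF y'(1), of id v] by simp
    ultimately show ?thesis unfolding related.simps by blast
  qed simp
next
  case (Par P1 P2)
  then show ?case
    unfolding related.simps using below_subst[of "Par _ _" Q \<tau>] by fastforce
next
  case (Sum P1 P2)
  then show ?case
    unfolding related.simps using below_subst[of "Sum _ _" Q \<tau>] by fastforce
next
  case (Ident A ys)
  then show ?case
    using below_subst[of "Ident A (map \<sigma> ys)" Q \<tau>]
    unfolding related.simps subst.simps map_map by blast
qed

text \<open>The analogue of \<open>subst_Res_eqI\<close> for relatedness: a single fresh instance
  gives all instances, by \<open>related_subst\<close>. The simulation of a restriction works at one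
  fresh name and returns under the binder in this way.\<close>

lemma related_rebind:
  assumes "related P (\<sigma>(x := w)) (Q\<lbrace>w/y\<rbrace>)" "w \<notin> \<sigma> ` (fn P - {x})" "w \<notin> fn Q - {y}"
  shows "related P (\<sigma>(x := v)) (Q\<lbrace>v/y\<rbrace>)"
proof -
  have "related P (id(w := v) \<circ> \<sigma>(x := w)) ((Q\<lbrace>w/y\<rbrace>)\<lbrace>v/w\<rbrace>)"
    by (rule related_subst) (rule assms(1))
  then have "related P (\<sigma>(x := v)) ((Q\<lbrace>w/y\<rbrace>)\<lbrace>v/w\<rbrace>)"
    by (rule related_cong) (use assms(2) in auto)
  then show ?thesis
    using subst_rebind1[OF assms(3)] by simp
qed

text \<open>Here a substitution moves from the environment into the left process, as after an input
  or a communication. The invisible subterms are then instantiated themselves, so this is the step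
  that rests on \<open>invisible_subst\<close>.\<close>

lemma related_pre: "related P (\<tau> \<circ> \<sigma>) Q \<Longrightarrow> related (subst P \<sigma>) \<tau> Q"
proof (induction P arbitrary: \<sigma> \<tau> Q)
  case Null
  then show ?case by simp
next
  case (Tau P)
  then show ?case
    using Tau.IH invisible_subst[of "Tau P" \<sigma>]
    unfolding related.simps subst.simps by blast
next
  case (Out a b P)
  then show ?case
    using Out.IH invisible_subst[of "Out a b P" \<sigma>]
    unfolding related.simps subst.simps comp_apply[of _ _ a] comp_apply[of _ _ b] by blast
next
  case (In a x P)
  obtain x' where x': "x' \<notin> \<sigma> ` (fn P - {x})"
    "\<And>b. subst (In b x P) \<sigma> = In (\<sigma> b) x' (subst P (\<sigma>(x := x')))"
    using subst_Res_fresh[of \<sigma> P x] by metis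
  show ?case
  proof (cases "invisible D (In a x P)")
    case True
    then show ?thesis by (intro related_invisible invisible_subst)
  next
    case False
    obtain b y Q1 where Q1: "(\<tau> \<circ> \<sigma>) a = b" "below (In b y Q1) Q"
      "\<And>v. related P ((\<tau> \<circ> \<sigma>)(x := v)) (Q1\<lbrace>v/y\<rbrace>)"
      by (rule related_InE[OF In.prems False], rule that)
    have "related (subst P (\<sigma>(x := x'))) (\<tau>(x' := v)) (Q1\<lbrace>v/y\<rbrace>)" for v
      by (rule In.IH, rule related_cong[OF Q1(3)]) (use x'(1) in auto)
    then show ?thesis
      using Q1(1) related_In_below[OF Q1(2)] unfolding x'(2) by simp
  qed
next
  case (Res x P)
  obtain x' where x': "x' \<notin> \<sigma> ` (fn P - {x})"
    "subst (Res x P) \<sigma> = Res x' (subst P (\<sigma>(x := x')))"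
    using subst_Res_fresh[of \<sigma> P x] by metis
  show ?case
  proof (cases "invisible D (Res x P)")
    case True
    then show ?thesis by (intro related_invisible invisible_subst)
  next
    case False
    obtain y Q1 where Q1: "below (Res y Q1) Q"
      "\<And>v. related P ((\<tau> \<circ> \<sigma>)(x := v)) (Q1\<lbrace>v/y\<rbrace>)"
      by (rule related_ResE[OF Res.prems False], rule that)
    have "related (subst P (\<sigma>(x := x'))) (\<tau>(x' := v)) (Q1\<lbrace>v/y\<rbrace>)" for v
      by (rule Res.IH, rule related_cong[OF Q1(2)]) (use x'(1) in auto)
    then show ?thesis
      using Q1(1) unfolding x'(2) by auto
  qed
next
  case (Par P1 P2)
  then show ?case
    using Par.IH invisible_subst[of "Par P1 P2" \<sigma>]
    unfolding related.simps subst.simps by blast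
next
  case (Sum P1 P2)
  then show ?case
    using Sum.IH invisible_subst[of "Sum P1 P2" \<sigma>]
    unfolding related.simps subst.simps by blast
next
  case (Ident A ys)
  then show ?case
    using invisible_subst[of "Ident A ys" \<sigma>]
    unfolding related.simps subst.simps map_map by blast
qed

lemma related_Par:
  "related P1 \<sigma> Q1 \<Longrightarrow> related P2 \<sigma> Q2 \<Longrightarrow> related (Par P1 P2) \<sigma> (Par Q1 Q2)"
  using below_refl by auto

lemma related_Res:
  "(\<And>v. related P (\<sigma>(x := v)) (Q\<lbrace>v/y\<rbrace>)) \<Longrightarrow> related (Res x P) \<sigma> (Res y Q)"
  using below_refl by auto

text \<open>This serves the parts in which nothing is replaced: the processes beside the hole and
  the unfolded bodies of identifiers.\<close>

lemma related_refl: "subst P \<sigma> = subst Q id \<Longrightarrow> related P \<sigma> Q"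
proof (induction P arbitrary: \<sigma> Q)
  case Null
  then show ?case by simp
next
  case (Tau P)
  then obtain Q1 where "Q = Tau Q1" "subst P \<sigma> = subst Q1 id"
    by (metis subst_eq_TauE)
  then show ?case unfolding related.simps using Tau.IH below_refl by blast
next
  case (Out a b P)
  then obtain Q1 where "Q = Out (\<sigma> a) (\<sigma> b) Q1" "subst P \<sigma> = subst Q1 id"
    by (metis subst_eq_OutE id_apply)
  then show ?case unfolding related.simps using Out.IH below_refl by blast
next
  case (In a x P)
  then obtain b y Q1 where Q: "Q = In b y Q1"
    by (cases Q) (auto simp: Let_def)
  then have "b = \<sigma> a" "\<And>v. subst P (\<sigma>(x := v)) = Q1\<lbrace>v/y\<rbrace>"
    using In.prems unfolding Q subst_In_eq_iff by auto
  moreover have "subst P (\<sigma>(x := v)) = Q1\<lbrace>v/y\<rbrace> \<Longrightarrow> related P (\<sigma>(x := v)) (Q1\<lbrace>v/y\<rbrace>)" for v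
    by (rule In.IH) (simp only: subst_comp id_comp)
  ultimately show ?case unfolding Q by (blast intro: related_In)
next
  case (Res x P)
  then obtain y Q1 where Q: "Q = Res y Q1"
    by (cases Q) (auto simp: Let_def)
  then have "\<And>v. subst P (\<sigma>(x := v)) = Q1\<lbrace>v/y\<rbrace>"
    using Res.prems unfolding Q subst_Res_eq_iff by auto
  moreover have "subst P (\<sigma>(x := v)) = Q1\<lbrace>v/y\<rbrace> \<Longrightarrow> related P (\<sigma>(x := v)) (Q1\<lbrace>v/y\<rbrace>)" for v
    by (rule Res.IH) (simp only: subst_comp id_comp)
  ultimately show ?case unfolding Q by (blast intro: related_Res)
next
  case (Par P1 P2)
  then obtain Q1 Q2 where "Q = Par Q1 Q2" "subst P1 \<sigma> = subst Q1 id" "subst P2 \<sigma> = subst Q2 id"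
    by (metis subst_eq_ParE)
  then show ?case using Par.IH by (blast intro: related_Par)
next
  case (Sum P1 P2)
  then obtain Q1 Q2 where "Q = Sum Q1 Q2" "subst P1 \<sigma> = subst Q1 id" "subst P2 \<sigma> = subst Q2 id"
    by (metis subst_eq_SumE)
  then show ?case unfolding related.simps using Sum.IH below_refl by blast
next
  case (Ident A ys)
  then have "Q = Ident A (map \<sigma> ys)"
    by (cases Q) (auto simp: Let_def)
  then show ?case using below_refl by auto
qed

text \<open>A binder above the hole captures names in both fillings alike. The instances required
  under it come from applying \<open>related_subst\<close> to the filled contexts below the
  binder.\<close>

lemma related_fill: "related I id P \<Longrightarrow> related (C\<lbrakk>I\<rbrakk>) id (C\<lbrakk>P\<rbrakk>)"
proof (induction C)
  case (CIn a x C)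
  have "related (C\<lbrakk>I\<rbrakk>) (id(x := v)) ((C\<lbrakk>P\<rbrakk>)\<lbrace>v/x\<rbrace>)" for v
    using related_subst[OF CIn.IH[OF CIn.prems], of "id(x := v)"] by (simp only: comp_id)
  then show ?case unfolding fill.simps by (intro related_In id_apply)
next
  case (CRes x C)
  have "related (C\<lbrakk>I\<rbrakk>) (id(x := v)) ((C\<lbrakk>P\<rbrakk>)\<lbrace>v/x\<rbrace>)" for v
    using related_subst[OF CRes.IH[OF CRes.prems], of "id(x := v)"] by (simp only: comp_id)
  then show ?case unfolding fill.simps by (rule related_Res)
qed (use below_refl related_refl in \<open>fastforce simp: related_Par simp del: related.simps(6)\<close>)+

section \<open>The weak simulation\<close>

text \<open>The case \<open>Q' = Q\<close> below answers a silent step of an invisible subterm.\<close>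

definition simulates_bound ::
    "(name \<Rightarrow> name \<Rightarrow> act) \<Rightarrow> (name \<Rightarrow> name) \<Rightarrow> 'k proc \<Rightarrow> name \<Rightarrow> name \<Rightarrow> 'k proc \<Rightarrow> bool" where
  "simulates_bound K \<sigma> Q a w P' \<longleftrightarrow> (\<forall>\<^sub>F w' in cofinite.
     \<exists>Q'. D \<turnstile> Q \<midarrow>K (\<sigma> a) w'\<rightarrow> Q' \<and> (\<forall>v. related P' (\<sigma>(w := v)) (Q'\<lbrace>v/w'\<rbrace>)))"

primrec simulates :: "(name \<Rightarrow> name) \<Rightarrow> 'k proc \<Rightarrow> act \<Rightarrow> 'k proc \<Rightarrow> bool" where
  "simulates \<sigma> Q TauA P' \<longleftrightarrow> (\<exists>Q'. (Q' = Q \<or> D \<turnstile> Q \<midarrow>TauA\<rightarrow> Q') \<and> related P' \<sigma> Q')"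
| "simulates \<sigma> Q (OutA a b) P' \<longleftrightarrow> (\<exists>Q'. D \<turnstile> Q \<midarrow>OutA (\<sigma> a) (\<sigma> b)\<rightarrow> Q' \<and> related P' \<sigma> Q')"
| "simulates \<sigma> Q (InA a w) P' \<longleftrightarrow> simulates_bound InA \<sigma> Q a w P'"
| "simulates \<sigma> Q (BOutA a w) P' \<longleftrightarrow> simulates_bound BOutA \<sigma> Q a w P'"

lemma simulates_K:
  "K \<in> {InA, BOutA} \<Longrightarrow> simulates \<sigma> Q (K a w) P' \<longleftrightarrow> simulates_bound K \<sigma> Q a w P'"
  by auto

lemma simulates_invisible:
  assumes "invisible D P" "D \<turnstile> P \<midarrow>\<alpha>\<rightarrow> P'"
  shows "simulates \<sigma> Q \<alpha> P'"
  using invisible_step[OF assms] by (auto intro: related_invisible)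

text \<open>If \<open>Q\<close> answers by idling, \<open>R\<close> idles too and leaves its choice
  or unfolding unperformed; otherwise \<open>R\<close> copies the transition of
  \<open>Q\<close>.\<close>

lemma simulates_below:
  assumes "simulates \<sigma> Q \<alpha> P'" "below Q R"
  shows "simulates \<sigma> R \<alpha> P'"
proof (cases \<alpha> rule: act_cases)
  case Tau
  then show ?thesis
    using assms related_below[OF _ assms(2)] below_step[OF assms(2)] unfolding Tau simulates.simps by blast
next
  case (Out a b)
  then show ?thesis
    using assms(1) below_step[OF assms(2)] unfolding Out simulates.simps by blast
next
  case (Bound K a w)
  have "simulates_bound K \<sigma> Q a w P'"
    using assms(1) Bound simulates_K by blast
  then have "simulates_bound K \<sigma> R a w P'"
    unfolding simulates_bound_def by (rule eventually_mono) (use below_step[OF assms(2)] in blast)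
  then show ?thesis
    using Bound simulates_K by blast
qed

lemma related_subst_fresh:
  assumes "related P \<sigma> Q" "w \<notin> fn P" "w' \<notin> \<sigma> ` fn P"
  shows "related P (\<sigma>(w := v)) (Q\<lbrace>v/w'\<rbrace>)"
proof (rule related_cong[OF related_subst[OF assms(1)]])
  fix n assume "n \<in> fn P"
  then have "n \<noteq> w" "\<sigma> n \<noteq> w'" using assms(2,3) by auto
  then show "(id(w' := v) \<circ> \<sigma>) n = (\<sigma>(w := v)) n" by simp
qed

lemma simulates_Par:
  assumes "simulates \<sigma> Q \<alpha> P'" "related R \<sigma> S" "bn \<alpha> \<inter> fn R = {}"
  shows "simulates \<sigma> (Par Q S) \<alpha> (Par P' R)" "simulates \<sigma> (Par S Q) \<alpha> (Par R P')"
proof -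
  have "simulates \<sigma> (Par Q S) \<alpha> (Par P' R) \<and> simulates \<sigma> (Par S Q) \<alpha> (Par R P')"
  proof (cases \<alpha> rule: act_cases)
    case Tau
    then obtain Q' where Q': "Q' = Q \<or> D \<turnstile> Q \<midarrow>TauA\<rightarrow> Q'" "related P' \<sigma> Q'"
      using assms(1) by auto
    then have "Par Q' S = Par Q S \<or> D \<turnstile> Par Q S \<midarrow>TauA\<rightarrow> Par Q' S"
      "Par S Q' = Par S Q \<or> D \<turnstile> Par S Q \<midarrow>TauA\<rightarrow> Par S Q'"
      using par_left[of D Q TauA Q' S] par_right[of D Q TauA Q' S] by auto
    then show ?thesis
      using related_Par[OF Q'(2) assms(2)] related_Par[OF assms(2) Q'(2)]
      unfolding Tau simulates.simps by blast
  next
    case (Out a b)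
    then obtain Q' where Q': "D \<turnstile> Q \<midarrow>OutA (\<sigma> a) (\<sigma> b)\<rightarrow> Q'" "related P' \<sigma> Q'"
      using assms(1) by auto
    then have "D \<turnstile> Par Q S \<midarrow>OutA (\<sigma> a) (\<sigma> b)\<rightarrow> Par Q' S" "D \<turnstile> Par S Q \<midarrow>OutA (\<sigma> a) (\<sigma> b)\<rightarrow> Par S Q'"
      using par_left[OF Q'(1), of S] par_right[OF Q'(1), of S] by auto
    then show ?thesis
      using related_Par[OF Q'(2) assms(2)] related_Par[OF assms(2) Q'(2)]
      unfolding Out simulates.simps by blast
  next
    case (Bound K a w)
    then have "simulates_bound K \<sigma> Q a w P'"
      using assms(1) simulates_K by blast
    then have ev: "\<forall>\<^sub>F w' in cofinite.
        \<exists>Q'. D \<turnstile> Q \<midarrow>K (\<sigma> a) w'\<rightarrow> Q' \<and> (\<forall>v. related P' (\<sigma>(w := v)) (Q'\<lbrace>v/w'\<rbrace>))"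
      unfolding simulates_bound_def .
    have w: "w \<notin> fn R"
      using assms(3) Bound by simp
    have fr: "\<forall>\<^sub>F w' in cofinite. w' \<notin> fn S \<union> \<sigma> ` fn R"
      by (rule cofinite_notin) simp
    have rest: "related R (\<sigma>(w := v)) (S\<lbrace>v/w'\<rbrace>)" if "w' \<notin> fn S \<union> \<sigma> ` fn R" for w' v
      using related_subst_fresh[OF assms(2) w] that by auto
    have "simulates_bound K \<sigma> (Par Q S) a w (Par P' R)"
      unfolding simulates_bound_def using ev fr
    proof eventually_elim
      case (elim w')
      then obtain Q' where Q': "D \<turnstile> Q \<midarrow>K (\<sigma> a) w'\<rightarrow> Q'" "\<And>v. related P' (\<sigma>(w := v)) (Q'\<lbrace>v/w'\<rbrace>)"
        by blast
      have "D \<turnstile> Par Q S \<midarrow>K (\<sigma> a) w'\<rightarrow> Par Q' S"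
        by (rule par_left[OF Q'(1)]) (use elim(2) Bound(1) in auto)
      moreover have "related (Par P' R) (\<sigma>(w := v)) ((Par Q' S)\<lbrace>v/w'\<rbrace>)" for v
        unfolding subst.simps by (rule related_Par[OF Q'(2) rest[OF elim(2)]])
      ultimately show ?case by blast
    qed
    moreover have "simulates_bound K \<sigma> (Par S Q) a w (Par R P')"
      unfolding simulates_bound_def using ev fr
    proof eventually_elim
      case (elim w')
      then obtain Q' where Q': "D \<turnstile> Q \<midarrow>K (\<sigma> a) w'\<rightarrow> Q'" "\<And>v. related P' (\<sigma>(w := v)) (Q'\<lbrace>v/w'\<rbrace>)"
        by blast
      have "D \<turnstile> Par S Q \<midarrow>K (\<sigma> a) w'\<rightarrow> Par S Q'"
        by (rule par_right[OF Q'(1)]) (use elim(2) Bound(1) in auto)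
      moreover have "related (Par R P') (\<sigma>(w := v)) ((Par S Q')\<lbrace>v/w'\<rbrace>)" for v
        unfolding subst.simps by (rule related_Par[OF rest[OF elim(2)] Q'(2)])
      ultimately show ?case by blast
    qed
    ultimately show ?thesis
      using Bound simulates_K by blast
  qed
  then show "simulates \<sigma> (Par Q S) \<alpha> (Par P' R)" "simulates \<sigma> (Par S Q) \<alpha> (Par R P')" by auto
qed

text \<open>A fresh \<open>v\<close> makes \<open>id(z := v)\<close> injective on
  \<open>fn Q\<close>, so no step of the instance is owed to the renaming.\<close>

lemma instance_step:
  assumes "D \<turnstile> Q\<lbrace>v/z\<rbrace> \<midarrow>\<alpha>\<rightarrow> Q'" "v \<notin> fn Q"
  shows "reflects (id(z := v)) Q \<alpha> Q'"
  by (rule reflects_injective[OF assms(1)])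
    (use assms(2) in \<open>auto simp: subst_comp inj_on_def\<close>)

text \<open>Relatedness under a restriction only speaks of instances of the bodies, whereas
  \<open>res\<close> needs a step of \<open>Q\<close> itself. With \<open>v\<close> fresh on both
  sides, \<open>instance_step\<close> pulls the step of the instance back to \<open>Q\<close>, and
  relatedness at \<open>v\<close> extends to all names.\<close>

lemma simulates_Res:
  assumes sim: "simulates (\<sigma>(y := v)) (Q\<lbrace>v/z\<rbrace>) \<alpha> P'" and step: "D \<turnstile> P \<midarrow>\<alpha>\<rightarrow> P'"
    and y: "y \<notin> names \<alpha>" and v: "v \<notin> \<sigma> ` fn P" "v \<notin> fn Q"
  shows "simulates \<sigma> (Res z Q) \<alpha> (Res y P')"
proof (cases \<alpha> rule: act_cases)
  case Tau
  have fnP': "v \<notin> \<sigma> ` (fn P' - {y})"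
    using fn_step[OF step] v(1) Tau by auto
  obtain Q1 where "Q1 = Q\<lbrace>v/z\<rbrace> \<or> D \<turnstile> Q\<lbrace>v/z\<rbrace> \<midarrow>TauA\<rightarrow> Q1" and rel: "related P' (\<sigma>(y := v)) Q1"
    using sim unfolding Tau simulates.simps by blast
  then consider "Q1 = Q\<lbrace>v/z\<rbrace>" | "D \<turnstile> Q\<lbrace>v/z\<rbrace> \<midarrow>TauA\<rightarrow> Q1" by blast
  then show ?thesis
  proof cases
    case 1
    have "related (Res y P') \<sigma> (Res z Q)"
      by (rule related_Res, rule related_rebind[OF rel[unfolded 1] fnP']) (use v(2) in simp)
    then show ?thesis unfolding Tau by auto
  next
    case 2
    obtain Q' where Q': "D \<turnstile> Q \<midarrow>TauA\<rightarrow> Q'" "Q'\<lbrace>v/z\<rbrace> = subst Q1 id"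
      using instance_step[OF 2 v(2)] by auto
    have "related P' (\<sigma>(y := v)) (Q'\<lbrace>v/z\<rbrace>)"
      using related_subst[OF rel, of id] unfolding Q'(2) id_comp .
    from related_rebind[OF this fnP'] have "related (Res y P') \<sigma> (Res z Q')"
      by (intro related_Res) (use v(2) fn_step[OF Q'(1)] in auto)
    then show ?thesis
      using res[OF Q'(1), of z] unfolding Tau simulates.simps by auto
  qed
next
  case (Out a b)
  have ab: "a \<in> fn P" "b \<in> fn P" "a \<noteq> y" "b \<noteq> y"
    using subject_in_fn[OF step] y Out by auto
  have fnP': "v \<notin> \<sigma> ` (fn P' - {y})"
    using fn_step[OF step] v(1) Out by auto
  obtain Q1 where Q1: "D \<turnstile> Q\<lbrace>v/z\<rbrace> \<midarrow>OutA (\<sigma> a) (\<sigma> b)\<rightarrow> Q1" and rel: "related P' (\<sigma>(y := v)) Q1"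
    using sim ab(3,4) unfolding Out simulates.simps by auto
  obtain a' b' Q' where Q': "D \<turnstile> Q \<midarrow>OutA a' b'\<rightarrow> Q'" "Q'\<lbrace>v/z\<rbrace> = subst Q1 id"
    and eq: "(id(z := v)) a' = \<sigma> a" "(id(z := v)) b' = \<sigma> b"
    using instance_step[OF Q1 v(2)] by auto
  \<comment> \<open>If \<open>a'\<close> or \<open>b'\<close> were \<open>z\<close>, its image would
    be \<open>v\<close>, which \<sigma> does not reach from \<open>fn P\<close>. Hence the
    restriction on \<open>z\<close> does not block the output.\<close>
  have "a' = \<sigma> a" "b' = \<sigma> b" "z \<noteq> a'" "z \<noteq> b'"
    using eq ab v(1) by (auto split: if_splits)
  then have "D \<turnstile> Res z Q \<midarrow>OutA (\<sigma> a) (\<sigma> b)\<rightarrow> Res z Q'"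
    using res[OF Q'(1), of z] by auto
  moreover have "related P' (\<sigma>(y := v)) (Q'\<lbrace>v/z\<rbrace>)"
    using related_subst[OF rel, of id] unfolding Q'(2) id_comp .
  from related_rebind[OF this fnP'] have "related (Res y P') \<sigma> (Res z Q')"
    by (intro related_Res) (use v(2) fn_step[OF Q'(1)] in auto)
  ultimately show ?thesis
    unfolding Out simulates.simps by blast
next
  case (Bound K a w)
  have a: "a \<in> fn P" "a \<noteq> y" and w: "w \<noteq> y"
    using bound_subject_in_fn[of P K a w P'] step y Bound by auto
  have fnP': "fn P' \<subseteq> insert w (fn P)"
    using fn_step[OF step] Bound by simp
  have "simulates_bound K (\<sigma>(y := v)) (Q\<lbrace>v/z\<rbrace>) a w P'"
    using sim Bound simulates_K by blast
  \<comment> \<open>One bound name \<open>w1\<close> is enough: reflecting the step back to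
    \<open>Q\<close> provides all but finitely many again.\<close>
  then obtain w1 Q1 where Q1: "D \<turnstile> Q\<lbrace>v/z\<rbrace> \<midarrow>K (\<sigma> a) w1\<rightarrow> Q1"
    and rel: "\<And>u. related P' (\<sigma>(y := v, w := u)) (Q1\<lbrace>u/w1\<rbrace>)"
    unfolding simulates_bound_def using a(2) by (auto dest!: ex_cofinite)
  have "reflects_bound K (id(z := v)) Q (\<sigma> a) w1 Q1"
    using instance_step[OF Q1 v(2)] reflects_K[OF Bound(1)] by blast
  then obtain a' where a': "(id(z := v)) a' = \<sigma> a"
    and ev: "\<forall>\<^sub>F w' in cofinite. \<exists>Q'. D \<turnstile> Q \<midarrow>K a' w'\<rightarrow> Q' \<and>
      (\<forall>u. subst Q' (id(z := v, w' := u)) = Q1\<lbrace>u/w1\<rbrace>)"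
    unfolding reflects_bound_def by blast
  have a'eq: "a' = \<sigma> a" "z \<noteq> a'"
    using a' a v(1) by (auto split: if_splits)
  have "\<forall>\<^sub>F w' in cofinite. w' \<notin> {z}"
    by (rule cofinite_notin) simp
  with ev have "simulates_bound K \<sigma> (Res z Q) a w (Res y P')"
    unfolding simulates_bound_def
  proof eventually_elim
    case (elim w')
    then obtain Q' where Q': "D \<turnstile> Q \<midarrow>K a' w'\<rightarrow> Q'"
      and eq: "\<And>u. subst Q' (id(z := v, w' := u)) = Q1\<lbrace>u/w1\<rbrace>" by blast
    have fnQ': "fn Q' \<subseteq> insert w' (fn Q)"
      using fn_step[OF Q'] Bound by simp
    have "related (Res y P') (\<sigma>(w := u)) ((Res z Q')\<lbrace>u/w'\<rbrace>)" for u
    proof -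
      obtain z' where z': "z' \<notin> (id(w' := u)) ` (fn Q' - {z})"
        "subst (Res z Q') (id(w' := u)) = Res z' (subst Q' (id(w' := u, z := z')))"
        using subst_Res_fresh[of "id(w' := u)" Q' z] by metis
      have "related P' (\<sigma>(w := u, y := t)) (subst Q' (id(w' := u, z := t)))" for t
      proof -
        have "finite ({v} \<union> \<sigma> ` fn P' \<union> fn Q')" by simp
        then obtain u' where u': "u' \<notin> {v} \<union> \<sigma> ` fn P' \<union> fn Q'" by (rule ex_fresh)
        have "related P' (id(v := t, u' := u) \<circ> \<sigma>(y := v, w := u'))
            (subst (Q1\<lbrace>u'/w1\<rbrace>) (id(v := t, u' := u)))"
          by (rule related_subst) (rule rel)
        moreover have "subst (Q1\<lbrace>u'/w1\<rbrace>) (id(v := t, u' := u)) = subst Q' (id(w' := u, z := t))"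
          unfolding eq[symmetric] subst_comp
        proof (rule subst_cong)
          fix n assume "n \<in> fn Q'"
          then have "n \<noteq> u'" "n \<noteq> w' \<Longrightarrow> n \<noteq> v"
            using u' fnQ' v(2) by auto
          then show "(id(v := t, u' := u) \<circ> id(z := v, w' := u')) n = (id(w' := u, z := t)) n"
            using u' elim(2) by auto
        qed
        ultimately have "related P' (id(v := t, u' := u) \<circ> \<sigma>(y := v, w := u'))
            (subst Q' (id(w' := u, z := t)))"
          by (simp only:)
        then show ?thesis
        proof (rule related_cong)
          fix n assume "n \<in> fn P'"
          then have "\<sigma> n \<noteq> u'" "n \<noteq> w \<Longrightarrow> \<sigma> n \<noteq> v"
            using u' fnP' v(1) by auto
          then show "(id(v := t, u' := u) \<circ> \<sigma>(y := v, w := u')) n = (\<sigma>(w := u, y := t)) n"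
            using u' w by auto
        qed
      qed
      then have "related P' (\<sigma>(w := u, y := t)) ((subst Q' (id(w' := u, z := z')))\<lbrace>t/z'\<rbrace>)" for t
        using subst_rebind[OF z'(1), of id t] by simp
      then show ?thesis
        unfolding z'(2) by (rule related_Res)
    qed
    moreover have "D \<turnstile> Res z Q \<midarrow>K (\<sigma> a) w'\<rightarrow> Res z Q'"
      using res[OF Q', of z] a'eq elim(2) Bound(1) by auto
    ultimately show ?case by blast
  qed
  then show ?thesis
    using Bound simulates_K by blast
qed

lemma related_bound_instance:
  assumes "\<And>v. related P (\<sigma>(w := v)) (Q\<lbrace>v/w'\<rbrace>)"
  shows "related (P\<lbrace>b/w\<rbrace>) \<sigma> (Q\<lbrace>\<sigma> b/w'\<rbrace>)"
  by (rule related_pre, rule related_cong[OF assms]) simp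

text \<open>If the source is invisible as a whole, idling answers its step; otherwise the same
  operator is exposed in some process below \<open>Q\<close>. Idling is permitted for silent steps
  only, so in the communication rules the induction hypotheses always deliver genuine transitions,
  and no invisible component can take part.\<close>

lemma step_simulate:
  "D \<turnstile> P \<midarrow>\<alpha>\<rightarrow> P' \<Longrightarrow> related P \<sigma> Q \<Longrightarrow> simulates \<sigma> Q \<alpha> P'"
proof (induction arbitrary: \<sigma> Q rule: step.induct)
  case (tau_act P)
  show ?case
  proof (cases "invisible D (Tau P)")
    case False
    then obtain Q1 where "below (Tau Q1) Q" "related P \<sigma> Q1"
      using tau_act by auto
    then show ?thesis
      using below_step[OF _ step.tau_act] unfolding simulates.simps by blast
  qed (rule simulates_invisible[OF _ step.tau_act])
next
  case (output_act a b P)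
  show ?case
  proof (cases "invisible D (Out a b P)")
    case False
    then obtain Q1 where "below (Out (\<sigma> a) (\<sigma> b) Q1) Q" "related P \<sigma> Q1"
      using output_act by auto
    then show ?thesis
      using below_step[OF _ step.output_act] unfolding simulates.simps by blast
  qed (rule simulates_invisible[OF _ step.output_act])
next
  case (input_act w z P a)
  show ?case
  proof (cases "invisible D (In a z P)")
    case False
    obtain b y Q1 where Q1: "\<sigma> a = b" "below (In b y Q1) Q" "\<And>v. related P (\<sigma>(z := v)) (Q1\<lbrace>v/y\<rbrace>)"
      by (rule related_InE[OF input_act(2) False], rule that)
    have "\<forall>\<^sub>F w' in cofinite. w' \<notin> fn (Res y Q1)"
      by (rule cofinite_notin) simp
    then have "simulates_bound InA \<sigma> Q a w (P\<lbrace>w/z\<rbrace>)"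
      unfolding simulates_bound_def
    proof eventually_elim
      case (elim w')
      have "related (P\<lbrace>w/z\<rbrace>) (\<sigma>(w := v)) (Q1\<lbrace>v/y\<rbrace>)" for v
        by (rule related_pre, rule related_cong[OF Q1(3)]) (use input_act(1) in auto)
      then have "related (P\<lbrace>w/z\<rbrace>) (\<sigma>(w := v)) ((Q1\<lbrace>w'/y\<rbrace>)\<lbrace>v/w'\<rbrace>)" for v
        using subst_rebind1[of w' Q1 y v] elim by simp
      then show ?case
        using below_step[OF Q1(2) step.input_act[OF elim]] Q1(1) by blast
    qed
    then show ?thesis by simp
  qed (rule simulates_invisible[OF _ step.input_act[OF input_act(1)]])
next
  case (sum_left P \<alpha> P' R)
  show ?case
  proof (cases "invisible D (Sum P R)")
    case False
    then obtain Q1 Q2 where Q12: "below (Sum Q1 Q2) Q" "related P \<sigma> Q1"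
      using sum_left.prems by auto
    show ?thesis
      by (rule simulates_below[OF sum_left.IH[OF Q12(2)]])
        (rule below_trans[OF Q12(1) below_Sum_left[OF below_refl]])
  qed (rule simulates_invisible[OF _ step.sum_left[OF sum_left.hyps(1)]])
next
  case (sum_right P \<alpha> P' R)
  show ?case
  proof (cases "invisible D (Sum R P)")
    case False
    then obtain Q1 Q2 where Q12: "below (Sum Q1 Q2) Q" "related P \<sigma> Q2"
      using sum_right.prems by auto
    show ?thesis
      by (rule simulates_below[OF sum_right.IH[OF Q12(2)]])
        (rule below_trans[OF Q12(1) below_Sum_right[OF below_refl]])
  qed (rule simulates_invisible[OF _ step.sum_right[OF sum_right.hyps(1)]])
next
  case (ide A xs B ys \<alpha> P')
  show ?case
  proof (cases "invisible D (Ident A ys)")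
    case False
    then have Q: "below (Ident A (map \<sigma> ys)) Q"
      using ide.prems by simp
    have len: "length (map \<sigma> ys) = length xs"
      using ide(2) by simp
    have "related (subst B (list_map xs ys)) \<sigma> (subst B (list_map xs (map \<sigma> ys)))"
      by (rule related_refl) (simp only: subst_body[OF ide(1,2)] subst_body[OF ide(1) len] list.map_id)
    from ide.IH[OF this] show ?thesis
      by (rule simulates_below) (rule below_trans[OF Q below_Ident[OF ide(1) len below_refl]])
  qed (use simulates_invisible step.ide[OF ide.hyps(1) ide.hyps(2) ide.hyps(3)] in blast)
next
  case (par_left P \<alpha> P' R)
  show ?case
  proof (cases "invisible D (Par P R)")
    case False
    then obtain Q1 Q2 where Q12: "below (Par Q1 Q2) Q" "related P \<sigma> Q1" "related R \<sigma> Q2"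
      using par_left.prems by auto
    show ?thesis
      by (rule simulates_below[OF _ Q12(1)],
          rule simulates_Par(1)[OF par_left.IH[OF Q12(2)] Q12(3) par_left.hyps(2)])
  qed (rule simulates_invisible[OF _ step.par_left[OF par_left.hyps]])
next
  case (par_right P \<alpha> P' R)
  show ?case
  proof (cases "invisible D (Par R P)")
    case False
    then obtain Q1 Q2 where Q12: "below (Par Q1 Q2) Q" "related R \<sigma> Q1" "related P \<sigma> Q2"
      using par_right.prems by auto
    show ?thesis
      by (rule simulates_below[OF _ Q12(1)],
          rule simulates_Par(2)[OF par_right.IH[OF Q12(3)] Q12(2) par_right.hyps(2)])
  qed (rule simulates_invisible[OF _ step.par_right[OF par_right.hyps]])
next
  case (com_left P a b P' R z R')
  show ?case
  proof (cases "invisible D (Par P R)")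
    case False
    then obtain Q1 Q2 where Q12: "below (Par Q1 Q2) Q" "related P \<sigma> Q1" "related R \<sigma> Q2"
      using com_left.prems by auto
    obtain Q1' where Q1': "D \<turnstile> Q1 \<midarrow>OutA (\<sigma> a) (\<sigma> b)\<rightarrow> Q1'" "related P' \<sigma> Q1'"
      using com_left.IH(1)[OF Q12(2)] by auto
    obtain w Q2' where Q2': "D \<turnstile> Q2 \<midarrow>InA (\<sigma> a) w\<rightarrow> Q2'"
      "\<And>v. related R' (\<sigma>(z := v)) (Q2'\<lbrace>v/w\<rbrace>)"
      using com_left.IH(2)[OF Q12(3)] by (auto simp: simulates_bound_def dest!: ex_cofinite)
    show ?thesis
      using below_step[OF Q12(1) step.com_left[OF Q1'(1) Q2'(1)]]
        related_Par[OF Q1'(2) related_bound_instance[OF Q2'(2)]]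
      unfolding simulates.simps by blast
  qed (rule simulates_invisible[OF _ step.com_left[OF com_left.hyps]])
next
  case (com_right P a z P' R b R')
  show ?case
  proof (cases "invisible D (Par P R)")
    case False
    then obtain Q1 Q2 where Q12: "below (Par Q1 Q2) Q" "related P \<sigma> Q1" "related R \<sigma> Q2"
      using com_right.prems by auto
    obtain w Q1' where Q1': "D \<turnstile> Q1 \<midarrow>InA (\<sigma> a) w\<rightarrow> Q1'"
      "\<And>v. related P' (\<sigma>(z := v)) (Q1'\<lbrace>v/w\<rbrace>)"
      using com_right.IH(1)[OF Q12(2)] by (auto simp: simulates_bound_def dest!: ex_cofinite)
    obtain Q2' where Q2': "D \<turnstile> Q2 \<midarrow>OutA (\<sigma> a) (\<sigma> b)\<rightarrow> Q2'" "related R' \<sigma> Q2'"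
      using com_right.IH(2)[OF Q12(3)] by auto
    show ?thesis
      using below_step[OF Q12(1) step.com_right[OF Q1'(1) Q2'(1)]]
        related_Par[OF related_bound_instance[OF Q1'(2)] Q2'(2)]
      unfolding simulates.simps by blast
  qed (rule simulates_invisible[OF _ step.com_right[OF com_right.hyps]])
next
  case (close_left P a w P' R R')
  show ?case
  proof (cases "invisible D (Par P R)")
    case False
    then obtain Q1 Q2 where Q12: "below (Par Q1 Q2) Q" "related P \<sigma> Q1" "related R \<sigma> Q2"
      using close_left.prems by auto
    have "simulates_bound BOutA \<sigma> Q1 a w P'" "simulates_bound InA \<sigma> Q2 a w R'"
      using close_left.IH(1)[OF Q12(2)] close_left.IH(2)[OF Q12(3)] by auto
    then obtain w' Q1' Q2' where Q': "D \<turnstile> Q1 \<midarrow>BOutA (\<sigma> a) w'\<rightarrow> Q1'" "D \<turnstile> Q2 \<midarrow>InA (\<sigma> a) w'\<rightarrow> Q2'"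
      "\<And>v. related P' (\<sigma>(w := v)) (Q1'\<lbrace>v/w'\<rbrace>)" "\<And>v. related R' (\<sigma>(w := v)) (Q2'\<lbrace>v/w'\<rbrace>)"
      unfolding simulates_bound_def using ex_cofinite[OF eventually_conj] by blast
    have "related (Res w (Par P' R')) \<sigma> (Res w' (Par Q1' Q2'))"
      by (rule related_Res, unfold subst.simps, rule related_Par[OF Q'(3,4)])
    then show ?thesis
      using below_step[OF Q12(1) step.close_left[OF Q'(1,2)]] unfolding simulates.simps by blast
  qed (rule simulates_invisible[OF _ step.close_left[OF close_left.hyps]])
next
  case (close_right P a w P' R R')
  show ?case
  proof (cases "invisible D (Par P R)")
    case False
    then obtain Q1 Q2 where Q12: "below (Par Q1 Q2) Q" "related P \<sigma> Q1" "related R \<sigma> Q2"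
      using close_right.prems by auto
    have "simulates_bound InA \<sigma> Q1 a w P'" "simulates_bound BOutA \<sigma> Q2 a w R'"
      using close_right.IH(1)[OF Q12(2)] close_right.IH(2)[OF Q12(3)] by auto
    then obtain w' Q1' Q2' where Q': "D \<turnstile> Q1 \<midarrow>InA (\<sigma> a) w'\<rightarrow> Q1'" "D \<turnstile> Q2 \<midarrow>BOutA (\<sigma> a) w'\<rightarrow> Q2'"
      "\<And>v. related P' (\<sigma>(w := v)) (Q1'\<lbrace>v/w'\<rbrace>)" "\<And>v. related R' (\<sigma>(w := v)) (Q2'\<lbrace>v/w'\<rbrace>)"
      unfolding simulates_bound_def using ex_cofinite[OF eventually_conj] by blast
    have "related (Res w (Par P' R')) \<sigma> (Res w' (Par Q1' Q2'))"
      by (rule related_Res, unfold subst.simps, rule related_Par[OF Q'(3,4)])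
    then show ?thesis
      using below_step[OF Q12(1) step.close_right[OF Q'(1,2)]] unfolding simulates.simps by blast
  qed (rule simulates_invisible[OF _ step.close_right[OF close_right.hyps]])
next
  case (res P \<alpha> P' y)
  show ?case
  proof (cases "invisible D (Res y P)")
    case False
    obtain z Q1 where Q1: "below (Res z Q1) Q" "\<And>v. related P (\<sigma>(y := v)) (Q1\<lbrace>v/z\<rbrace>)"
      by (rule related_ResE[OF res.prems False], rule that)
    have "finite (\<sigma> ` fn P \<union> fn Q1)" by simp
    then obtain v where v: "v \<notin> \<sigma> ` fn P \<union> fn Q1" by (rule ex_fresh)
    have "simulates \<sigma> (Res z Q1) \<alpha> (Res y P')"
      by (rule simulates_Res[OF res.IH[OF Q1(2)] res.hyps]) (use v in auto)
    then show ?thesis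
      by (rule simulates_below[OF _ Q1(1)])
  qed (rule simulates_invisible[OF _ step.res[OF res.hyps]])
next
  case (open_scope P a y P' w)
  show ?case
  proof (cases "invisible D (Res y P)")
    case False
    obtain z Q1 where Q1: "below (Res z Q1) Q" "\<And>v. related P (\<sigma>(y := v)) (Q1\<lbrace>v/z\<rbrace>)"
      by (rule related_ResE[OF open_scope.prems False], rule that)
    have "finite (\<sigma> ` fn P \<union> fn Q1)" by simp
    then obtain v where v: "v \<notin> \<sigma> ` fn P \<union> fn Q1" by (rule ex_fresh)
    \<comment> \<open>At the instance \<open>v\<close> the restricted name \<open>y\<close> is sent
      out as \<open>v\<close>, so the answer outputs \<open>v\<close>. As \<open>v\<close> is fresh
      for \<open>Q1\<close>, this is an output of the binder \<open>z\<close> of \<open>Q1\<close>,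
      whose scope can be opened in turn.\<close>
    obtain R where R: "D \<turnstile> Q1\<lbrace>v/z\<rbrace> \<midarrow>OutA (\<sigma> a) v\<rightarrow> R" and rel: "related P' (\<sigma>(y := v)) R"
      using open_scope.IH[OF Q1(2), of v] open_scope.hyps(2)
      unfolding simulates.simps by (metis fun_upd_other fun_upd_same)
    have "v \<notin> fn Q1" using v by simp
    from instance_step[OF R this] obtain a' b' Q' where Q': "D \<turnstile> Q1 \<midarrow>OutA a' b'\<rightarrow> Q'"
        "Q'\<lbrace>v/z\<rbrace> = subst R id"
      and eq: "(id(z := v)) a' = \<sigma> a" "(id(z := v)) b' = v"
      by auto
    have "a \<in> fn P" "b' \<in> fn Q1"
      using subject_in_fn[OF open_scope.hyps(1)] subject_in_fn[OF Q'(1)] by auto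
    then have a': "a' = \<sigma> a" "z \<noteq> \<sigma> a" "b' = z"
      using eq v by (auto split: if_splits)
    have "related P' (\<sigma>(y := v)) (Q'\<lbrace>v/z\<rbrace>)"
      using related_subst[OF rel, of id] unfolding Q'(2) id_comp .
    then have rel': "related P' (\<sigma>(y := u)) (Q'\<lbrace>u/z\<rbrace>)" for u
      by (rule related_rebind) (use v fn_step[OF open_scope.hyps(1)] fn_step[OF Q'(1)] in auto)
    have "\<forall>\<^sub>F w' in cofinite. w' \<notin> fn (Res z Q')"
      by (rule cofinite_notin) simp
    then have "simulates_bound BOutA \<sigma> Q a w (P'\<lbrace>w/y\<rbrace>)"
      unfolding simulates_bound_def
    proof eventually_elim
      case (elim w')
      have "related (P'\<lbrace>w/y\<rbrace>) (\<sigma>(w := u)) (Q'\<lbrace>u/z\<rbrace>)" for u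
        by (rule related_pre, rule related_cong[OF rel']) (use open_scope.hyps(3) in auto)
      then have "related (P'\<lbrace>w/y\<rbrace>) (\<sigma>(w := u)) ((Q'\<lbrace>w'/z\<rbrace>)\<lbrace>u/w'\<rbrace>)" for u
        using subst_rebind1[of w' Q' z u] elim by simp
      moreover have "D \<turnstile> Res z Q1 \<midarrow>BOutA (\<sigma> a) w'\<rightarrow> Q'\<lbrace>w'/z\<rbrace>"
        by (rule step.open_scope) (use Q'(1) a' elim in auto)
      ultimately show ?case
        using below_step[OF Q1(1)] by blast
    qed
    then show ?thesis by simp
  qed (rule simulates_invisible[OF _ step.open_scope[OF open_scope.hyps]])
qed

text \<open>Idle answers do no harm: the induction runs over the silent steps of \<open>P\<close>,
  and its final visible action cannot be answered by idling.\<close>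

lemma related_weakly_visible: "D \<turnstile> P\<Down> \<Longrightarrow> related P \<sigma> Q \<Longrightarrow> D \<turnstile> Q\<Down>"
proof (induction arbitrary: Q rule: weakly_visible_induct)
  case (step P \<alpha> P')
  have "simulates \<sigma> Q \<alpha> P'"
    by (rule step_simulate[OF step(1,3)])
  then show ?case
    using step(2) by (cases \<alpha>)
      (auto simp: simulates_bound_def dest!: ex_cofinite intro: weakly_visible_step)
next
  case (tau P P')
  then obtain Q' where "Q' = Q \<or> D \<turnstile> Q \<midarrow>TauA\<rightarrow> Q'" "related P' \<sigma> Q'"
    using step_simulate[OF tau(1,3)] by auto
  then show ?case
    using tau.IH weakly_visible_tau by blast
qed

end

theorem theorem3p6:
  fixes D :: "'k defs"
  assumes "defining_equations D"
  shows "strongly_replacement_free D"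
  unfolding strongly_replacement_free_def
  using related_weakly_visible[OF assms _ related_fill[OF assms related_invisible[OF assms]]] by blast

end
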